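(* Let $c>0$, $t>0$ and $n\ge 1$ an integer, and let $\underline{\mathbf X}_d(t)$ ($d\ge2$) and $\underline{\mathbf Y}_d(t)$ ($d\ge3$) be the positions at time $t$ of the $d$-dimensional random flights with $n$ changes of direction defined in the context. Let $1\le m<d$. Then the projections $(X_1(t),\dots,X_m(t))$ of $\underline{\mathbf X}_d(t)$ and $(Y_1(t),\dots,Y_m(t))$ of $\underline{\mathbf Y}_d(t)$ onto $\mathbb{R}^m$ have respectively the densities $$f_{\underline{\mathbf X}_m}^d(\underline{\mathbf x}_m,t;n)=\frac{\Gamma\left(\frac{n+1}{2}(d-1)+\frac12\right)}{\Gamma\left(\frac{n+1}{2}(d-1)+\frac{1-m}{2}\right)}\frac{(c^2t^2-\|\underline{\mathbf x}_m\|^2)^{\frac{n+1}{2}(d-1)-\frac{m+1}{2}}}{\pi^{\frac m2}(ct)^{(n+1)(d-1)-1}},\qquad \|\underline{\mathbf x}_m\|<ct,$$ $$f_{\underline{\mathbf Y}_m}^d(\underline{\mathbf y}_m,t;n)=\frac{\Gamma\left((n+1)(\frac d2-1)+1\right)}{\Gamma\left((n+1)(\frac d2-1)+1-\frac m2\right)}\frac{(c^2t^2-\|\underline{\mathbf y}_{m}\|^2)^{(n+1)(\frac d2-1)-\frac m2}}{\pi^{\frac m2}(ct)^{2(n+1)(\frac d2-1)}},\qquad \|\underline{\mathbf y}_m\|<ct.$$ Moreover, for $m=d$ these two expressions coincide respectively with the density of $\underline{\mathbf X}_d(t)$, $$\frac{\Gamma\left(\frac{n+1}{2}(d-1)+\frac12\right)}{\Gamma\left(\frac{n}{2}(d-1)\right)}\frac{(c^2t^2-\|\underline{\mathbf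 x}_d\|^2)^{\frac{n}{2}(d-1)-1}}{\pi^{d/2}(ct)^{(n+1)(d-1)-1}},\qquad \|\underline{\mathbf x}_d\|<ct,$$ and with the density of $\underline{\mathbf Y}_d(t)$, $$\frac{\Gamma\left((n+1)(\frac d2-1)+1\right)}{\Gamma\left(n(\frac d2-1)\right)}\frac{(c^2t^2-\|\underline{\mathbf y}_d\|^2)^{n(\frac d2-1)-1}}{\pi^{d/2}(ct)^{2(n+1)(\frac d2-1)}},\qquad \|\underline{\mathbf y}_d\|<ct.$$
   Context: $\|\cdot\|$ is the Euclidean norm; $\underline{\mathbf x}_m=(x_1,\dots,x_m)\in\mathbb{R}^m$. Densities are with respect to Lebesgue measure and vanish outside the indicated balls. Random flights with a fixed number $n\ge1$ of changes of direction. Fix $c>0$ (speed), $t>0$. Let $V_1,\dots,V_{n+1}$ be independent random vectors uniformly distributed on the unit sphere of $\mathbb{R}^d$ (in hyperspherical coordinates $(\theta_1,\dots,\theta_{d-2},\phi)\in[0,\pi]^{d-2}\times[0,2\pi]$ each has joint density $\frac{\Gamma(d/2)}{2\pi^{d/2}}\sin^{d-2}\theta_1\sin^{d-3}\theta_2\cdots\sin\theta_{d-2}$). Let $(\tau_1,\dots,\tau_n)$ be a random vector independent of the $V_j$'s, with $\tau_j>0$, $\sum_{j=1}^n\tau_j<t$, and put $\tau_{n+1}=t-\sum_{j=1}^n\tau_j$. The position at time $t$ is $c\sum_{j=1}^{n+1}\tau_jV_j$. For $d\ge2$, $\underline{\mathbf X}_d(t)=(X_1(t),\dots,X_d(t))$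 denotes this position when $(\tau_1,\dots,\tau_n)$ has the rescaled Dirichlet density $$f_1(\tau_1,\dots,\tau_n)=\frac{\Gamma((n+1)(d-1))}{(\Gamma(d-1))^{n+1}}\frac{1}{t^{(n+1)(d-1)-1}}\prod_{j=1}^{n+1}\tau_j^{d-2}$$ on $\{\tau_j>0,\ \sum_{j=1}^n\tau_j<t\}$. For $d\ge3$, $\underline{\mathbf Y}_d(t)=(Y_1(t),\dots,Y_d(t))$ denotes this position when $(\tau_1,\dots,\tau_n)$ has the rescaled Dirichlet density $$f_2(\tau_1,\dots,\tau_n)=\frac{\Gamma((n+1)(\frac d2-1))}{(\Gamma(\frac d2-1))^{n+1}}\frac{1}{t^{(n+1)(\frac d2-1)-1}}\prod_{j=1}^{n+1}\tau_j^{\frac d2-2}$$ on the same set. *)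

theory Defs
  imports "HOL-Probability.Probability"
begin

text \<open>
  Points of $\mathbf{R}^k$ are extensional functions on \<open>{1..k}\<close>, i.e. elements of the product space
  \<open>PiM {1..k} (\<lambda>_. lborel)\<close>, whose measure is Lebesgue measure on $\mathbf{R}^k$.
  The Euclidean norm of such a point is \<open>L2_set x {1..k}\<close>, and the projection onto the
  first \<open>m\<close> coordinates is \<open>restrict x {1..m}\<close>.
\<close>

text \<open>
  For \<open>d \<ge> 2\<close> the entries \<open>1..d-2\<close> of the angle vector are $\theta_1,\dots,\theta_{d-2}$ and
  the entry \<open>d-1\<close> is $\phi$. The coordinates of the direction are
  $\cos\theta_1,\ \sin\theta_1\cos\theta_2,\ \dots,\
  \sin\theta_1\cdots\sin\theta_{d-2}\cos\phi,\ \sin\theta_1\cdots\sin\theta_{d-2}\sin\phi$.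
\<close>

definition hyperspherical :: "nat \<Rightarrow> (nat \<Rightarrow> real) \<Rightarrow> (nat \<Rightarrow> real)" where
  "hyperspherical d \<psi> =
     (\<lambda>k\<in>{1..d}. (\<Prod>i\<in>{1..<k}. sin (\<psi> i)) * (if k < d then cos (\<psi> k) else 1))"

definition angle_density :: "nat \<Rightarrow> (nat \<Rightarrow> real) \<Rightarrow> real" where
  "angle_density d \<psi> =
     (if (\<forall>i\<in>{1..d-2}. 0 \<le> \<psi> i \<and> \<psi> i \<le> pi) \<and> 0 \<le> \<psi> (d-1) \<and> \<psi> (d-1) \<le> 2 * pi
      then Gamma (real d / 2) / (2 * pi powr (real d / 2)) * (\<Prod>i\<in>{1..d-2}. sin (\<psi> i) ^ (d - 1 - i))
      else 0)"

definition uniform_sphere :: "nat \<Rightarrow> (nat \<Rightarrow> real) measure" where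
  "uniform_sphere d =
     distr (density (PiM {1..d-1} (\<lambda>_. lborel)) (\<lambda>\<psi>. ennreal (angle_density d \<psi>)))
       (PiM {1..d} (\<lambda>_. borel)) (hyperspherical d)"

lemma measurable_hyperspherical [measurable]:
  "hyperspherical d \<in> PiM {1..d-1} (\<lambda>_. lborel) \<rightarrow>\<^sub>M PiM {1..d} (\<lambda>_. borel)"
  unfolding hyperspherical_def
proof (rule measurable_restrict)
  fix k assume k: "k \<in> {1..d}"
  have comp: "(\<lambda>\<psi>::nat\<Rightarrow>real. \<psi> i) \<in> borel_measurable (PiM {1..d-1} (\<lambda>_. lborel))"
    if "i \<in> {1..d-1}" for i
    using measurable_component_singleton[OF that, of "\<lambda>_. lborel :: real measure"] by simp
  have "(\<lambda>\<psi>::nat\<Rightarrow>real. \<Prod>i\<in>{1..<k}. sin (\<psi> i)) \<in> borel_measurable (PiM {1..d-1} (\<lambda>_. lborel))"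
    using k by (intro borel_measurable_prod borel_measurable_sin comp) auto
  moreover have "(\<lambda>\<psi>::nat\<Rightarrow>real. if k < d then cos (\<psi> k) else 1)
      \<in> borel_measurable (PiM {1..d-1} (\<lambda>_. lborel))"
    using k by (cases "k < d") (auto intro!: borel_measurable_cos comp)
  ultimately show "(\<lambda>\<psi>::nat\<Rightarrow>real. (\<Prod>i\<in>{1..<k}. sin (\<psi> i)) * (if k < d then cos (\<psi> k) else 1))
      \<in> borel_measurable (PiM {1..d-1} (\<lambda>_. lborel))"
    by (rule borel_measurable_times)
qed

text \<open>The last duration is what the first \<open>n\<close> leave of the total time.\<close>

definition durations :: "nat \<Rightarrow> real \<Rightarrow> (nat \<Rightarrow> real) \<Rightarrow> nat \<Rightarrow> real" where
  "durations n t s j = (if j = n + 1 then t - (\<Sum>i\<in>{1..n}. s i) else s j)"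

definition dirichlet_density :: "real \<Rightarrow> nat \<Rightarrow> real \<Rightarrow> (nat \<Rightarrow> real) \<Rightarrow> real" where
  "dirichlet_density a n t s =
     (if (\<forall>j\<in>{1..n}. 0 < s j) \<and> (\<Sum>j\<in>{1..n}. s j) < t
      then Gamma ((real n + 1) * a) / Gamma a ^ (n + 1) * (1 / t powr ((real n + 1) * a - 1))
           * (\<Prod>j\<in>{1..n+1}. durations n t s j powr (a - 1))
      else 0)"

text \<open>
  The two vector families in \<open>indep_times\<close> have values in different types, so their independence
  is stated as independence of the generated sigma-algebras instead of by \<open>indep_var\<close>.
  Positivity of the durations, and their sum being below \<open>t\<close>, hold almost surely for every
  density \<open>f\<close> that vanishes elsewhere, as \<open>dirichlet_density\<close> does.
\<close>

locale random_flight = prob_space M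
  for M :: "'a measure" and d n :: nat and f :: "(nat \<Rightarrow> real) \<Rightarrow> real"
    and V :: "nat \<Rightarrow> 'a \<Rightarrow> nat \<Rightarrow> real" and \<tau> :: "'a \<Rightarrow> nat \<Rightarrow> real" +
  assumes indep_directions: "indep_vars (\<lambda>_. PiM {1..d} (\<lambda>_. borel)) V {1..n+1}"
    and distr_direction:
      "\<And>j. j \<in> {1..n+1} \<Longrightarrow> distr M (PiM {1..d} (\<lambda>_. borel)) (V j) = uniform_sphere d"
    and distributed_times: "distributed M (PiM {1..n} (\<lambda>_. lborel)) \<tau> (\<lambda>s. ennreal (f s))"
    and indep_times:
      "indep_set
         (sets (vimage_algebra (space M) \<tau> (PiM {1..n} (\<lambda>_. borel))))
         (sets (vimage_algebra (space M) (\<lambda>\<omega>. \<lambda>j\<in>{1..n+1}. V j \<omega>)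
            (PiM {1..n+1} (\<lambda>_. PiM {1..d} (\<lambda>_. borel)))))"

definition flight_position ::
  "nat \<Rightarrow> nat \<Rightarrow> real \<Rightarrow> real \<Rightarrow> (nat \<Rightarrow> 'a \<Rightarrow> nat \<Rightarrow> real) \<Rightarrow> ('a \<Rightarrow> nat \<Rightarrow> real) \<Rightarrow> 'a \<Rightarrow> nat \<Rightarrow> real"
where
  "flight_position d n c t V \<tau> \<omega> =
     (\<lambda>k\<in>{1..d}. c * (\<Sum>j\<in>{1..n+1}. durations n t (\<tau> \<omega>) j * V j \<omega> k))"

definition density_X_proj :: "nat \<Rightarrow> nat \<Rightarrow> nat \<Rightarrow> real \<Rightarrow> real \<Rightarrow> (nat \<Rightarrow> real) \<Rightarrow> real" where
  "density_X_proj d m n c t x =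
     (if L2_set x {1..m} < c * t
      then Gamma ((real n + 1) / 2 * (real d - 1) + 1 / 2)
             / Gamma ((real n + 1) / 2 * (real d - 1) + (1 - real m) / 2)
           * ((c\<^sup>2 * t\<^sup>2 - (L2_set x {1..m})\<^sup>2) powr ((real n + 1) / 2 * (real d - 1) - (real m + 1) / 2)
             / (pi powr (real m / 2) * (c * t) powr ((real n + 1) * (real d - 1) - 1)))
      else 0)"

definition density_Y_proj :: "nat \<Rightarrow> nat \<Rightarrow> nat \<Rightarrow> real \<Rightarrow> real \<Rightarrow> (nat \<Rightarrow> real) \<Rightarrow> real" where
  "density_Y_proj d m n c t y =
     (if L2_set y {1..m} < c * t
      then Gamma ((real n + 1) * (real d / 2 - 1) + 1)
             / Gamma ((real n + 1) * (real d / 2 - 1) + 1 - real m / 2)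
           * ((c\<^sup>2 * t\<^sup>2 - (L2_set y {1..m})\<^sup>2) powr ((real n + 1) * (real d / 2 - 1) - real m / 2)
             / (pi powr (real m / 2) * (c * t) powr (2 * (real n + 1) * (real d / 2 - 1))))
      else 0)"

definition density_X :: "nat \<Rightarrow> nat \<Rightarrow> real \<Rightarrow> real \<Rightarrow> (nat \<Rightarrow> real) \<Rightarrow> real" where
  "density_X d n c t x =
     (if L2_set x {1..d} < c * t
      then Gamma ((real n + 1) / 2 * (real d - 1) + 1 / 2) / Gamma (real n / 2 * (real d - 1))
           * ((c\<^sup>2 * t\<^sup>2 - (L2_set x {1..d})\<^sup>2) powr (real n / 2 * (real d - 1) - 1)
             / (pi powr (real d / 2) * (c * t) powr ((real n + 1) * (real d - 1) - 1)))
      else 0)"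

definition density_Y :: "nat \<Rightarrow> nat \<Rightarrow> real \<Rightarrow> real \<Rightarrow> (nat \<Rightarrow> real) \<Rightarrow> real" where
  "density_Y d n c t y =
     (if L2_set y {1..d} < c * t
      then Gamma ((real n + 1) * (real d / 2 - 1) + 1) / Gamma (real n * (real d / 2 - 1))
           * ((c\<^sup>2 * t\<^sup>2 - (L2_set y {1..d})\<^sup>2) powr (real n * (real d / 2 - 1) - 1)
             / (pi powr (real d / 2) * (c * t) powr (2 * (real n + 1) * (real d / 2 - 1))))
      else 0)"

end

theory Submission
  imports Defs
begin

text \<open>The argument uses moment generating functions instead of characteristic functions, so that every
  series and every integral has nonnegative terms and no convergence question arises. For a uniform
  direction \<open>V\<close>, $E\,e^{\langle\xi,V\rangle} = {}_0F_1(;\frac d2;\frac{|\xi|^2}4)$. Conditioning on the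
  durations, the moment generating function of the position becomes an $(n+1)$-fold convolution of functions
  $s^{a-1}\,{}_0F_1(;q(a);\kappa s^2)$, where $q(a) = \frac{a+1}2$ for $a = d-1$ and $q(a) = a+1$ for
  $a = \frac d2-1$; both families are closed under convolution with the parameters \<open>a\<close> adding up, by the
  Vandermonde and the Rothe-Hagen identity respectively. The outcome
  ${}_0F_1(;Q;\frac{c^2t^2|\xi|^2}4)$ with $Q = q((n+1)a)$ is also the moment generating function of the
  density proportional to $(c^2t^2-|x|^2)^{Q-m/2-1}$ on the ball of radius \<open>ct\<close> in $\mathbf{R}^m$, for every
  \<open>m \<le> d\<close>. A compactly supported law is determined by its moment generating function, by the
  Stone-Weierstrass theorem for the span of the functions $e^{\langle\xi,x\rangle}$.\<close>

subsection \<open>The hypergeometric series $_0F_1$\<close>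

text \<open>The exponents of the two Dirichlet laws are tuned to the dimension: the parameter d/2
  contributed by a uniform direction has to be the value q(a) at the very exponent a of the
  durations, and (a+1)/2 at a = d-1 and a+1 at a = d/2-1 are both d/2. Convolution then changes only
  a, to (n+1)a. The weight of a duration s is a power of s while the argument of 0F1 is quadratic in
  s; this is why the coefficient identities contain Pochhammer symbols of even length 2i. To
  project, no density is integrated over the discarded coordinates. Setting their frequencies to 0
  gives the transform of the projection, with Q unchanged, so m < d and m = d are one case. What is
  asked of m is Q - m/2 > 0. Since Q - d/2 is n(d-1)/2 for X and n(d/2-1) for Y, the assumption n >=
  1 is what admits m = d.\<close>

lemma suminf_suminf_ennreal_commute:
  fixes f :: "nat \<Rightarrow> nat \<Rightarrow> ennreal"
  shows "(\<Sum>i. \<Sum>k. f i k) = (\<Sum>k. \<Sum>i. f i k)"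
proof -
  have "(\<Sum>i. \<Sum>k. f i k) = (\<integral>\<^sup>+i. (\<Sum>k. f i k) \<partial>count_space UNIV)"
    by (simp add: nn_integral_count_space_nat)
  also have "\<dots> = (\<Sum>k. \<integral>\<^sup>+i. f i k \<partial>count_space UNIV)"
    by (rule nn_integral_suminf) simp
  finally show ?thesis
    by (simp add: nn_integral_count_space_nat)
qed

lemma suminf_suminf_ennreal_triangle:
  fixes f :: "nat \<Rightarrow> nat \<Rightarrow> ennreal"
  shows "(\<Sum>i. \<Sum>k. f i k) = (\<Sum>N. \<Sum>i\<le>N. f i (N - i))"
proof -
  define g where "g i N = (if i \<le> N then f i (N - i) else 0)" for i N
  have "(\<Sum>k. f i k) = (\<Sum>N. g i N)" for i
  proof -
    have "(\<Sum>N. g i N) = (\<Sum>N. g i (N + i)) + (\<Sum>N<i. g i N)"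
      by (rule suminf_offset) simp
    then show ?thesis
      by (simp add: g_def)
  qed
  moreover have "(\<Sum>i. g i N) = (\<Sum>i\<le>N. f i (N - i))" for N
    by (subst suminf_finite[of "{..N}"]) (auto simp: g_def)
  ultimately show ?thesis
    by (simp add: suminf_suminf_ennreal_commute[of g])
qed

lemma powr_add_nat:
  fixes x e :: real
  assumes "x > 0"
  shows "x powr (e + real k) = x powr e * x ^ k"
  using assms by (simp add: powr_add powr_realpow)

lemma Gamma_shift:
  fixes q :: real
  assumes "q > 0"
  shows "Gamma (q + real k) = pochhammer q k * Gamma q"
proof -
  have "q \<notin> \<int>\<^sub>\<le>\<^sub>0" using assms nonpos_Ints_nonpos[of q] by auto
  moreover have "Gamma q > 0" using assms by (rule Gamma_real_pos)
  ultimately show ?thesis using pochhammer_Gamma[of q k] by simp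
qed

text \<open>The series $_0F_1(;q;z)$; at negative \<open>z\<close> it is a Bessel function, up to a power and a constant.\<close>

definition hyp01 :: "real \<Rightarrow> real \<Rightarrow> ennreal" where
  "hyp01 q z = (\<Sum>k. ennreal (z ^ k / (fact k * pochhammer q k)))"

lemma measurable_hyp01 [measurable]: "hyp01 q \<in> borel_measurable borel"
  unfolding hyp01_def by measurable

lemma hyp01_0 [simp]: "hyp01 q 0 = 1"
  unfolding hyp01_def by (subst suminf_finite[of "{0}"]) (auto simp: power_0_left)

lemma fact_double_pochhammer: "(fact (2 * k) :: real) = 4 ^ k * fact k * pochhammer (1/2) k"
  by (simp add: fact_double power_mult)

text \<open>The parameter 1/2 comes from (2k)! = 4^k k! (1/2)_k. This is the start of every
  parameter count below: symmetrising an exponential over u and -u yields cosh, which thereby enters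
  as a 0F1.\<close>

lemma hyp01_half: "hyp01 (1/2) (z\<^sup>2 / 4) = ennreal (cosh z)"
proof -
  let ?f = "\<lambda>n. if even n then z ^ n /\<^sub>R fact n else 0"
  have "(\<lambda>k. ?f (2 * k)) sums cosh z \<longleftrightarrow> ?f sums cosh z"
    by (rule sums_mono_reindex) (auto simp: strict_mono_def elim!: evenE)
  then have "(\<lambda>k. z ^ (2 * k) / fact (2 * k)) sums cosh z"
    using cosh_converges[of z] by (simp add: field_simps)
  also have "(\<lambda>k. z ^ (2 * k) / fact (2 * k)) = (\<lambda>k. (z\<^sup>2 / 4) ^ k / (fact k * pochhammer (1/2) k))"
    by (simp add: fact_double_pochhammer power_mult power_divide mult.assoc)
  finally show ?thesis
    unfolding hyp01_def
    by (intro suminf_ennreal_eq) (auto intro!: divide_nonneg_nonneg mult_nonneg_nonneg pochhammer_nonneg)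
qed

section \<open>Beta integrals\<close>

lemma nn_integral_beta:
  fixes a b T :: real
  assumes "a > 0" "b > 0" "T > 0"
  shows "(\<integral>\<^sup>+s. ennreal (s powr (a - 1) * (T - s) powr (b - 1)) * indicator {0..T} s \<partial>lborel)
     = ennreal (T powr (a + b - 1) * Beta a b)"
proof -
  have unit: "(\<integral>\<^sup>+s. ennreal (s powr (a - 1) * (1 - s) powr (b - 1)) * indicator {0..1} s \<partial>lborel)
     = ennreal (Beta a b)"
    using has_integral_Beta_real[OF assms(1,2)]
    by (intro nn_integral_has_integral_lebesgue') auto
  have "(\<integral>\<^sup>+s. ennreal (s powr (a - 1) * (T - s) powr (b - 1)) * indicator {0..T} s \<partial>lborel)
     = \<bar>T\<bar> * (\<integral>\<^sup>+s. ennreal ((0 + T * s) powr (a - 1) * (T - (0 + T * s)) powr (b - 1)) * indicator {0..T} (0 + T * s) \<partial>lborel)"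
    using assms by (intro nn_integral_real_affine) auto
  also have "\<dots> = \<bar>T\<bar> * (\<integral>\<^sup>+s. ennreal (T powr (a + b - 2)) * (ennreal (s powr (a - 1) * (1 - s) powr (b - 1)) * indicator {0..1} s) \<partial>lborel)"
  proof (rule arg_cong[where f="\<lambda>x. ennreal \<bar>T\<bar> * x"], rule nn_integral_cong)
    fix s :: real
    have "(T * s) powr (a - 1) * (T - T * s) powr (b - 1)
        = T powr (a + b - 2) * (s powr (a - 1) * (1 - s) powr (b - 1))" if "0 \<le> s" "s \<le> 1"
    proof -
      have "T - T * s = T * (1 - s)" by (simp add: algebra_simps)
      moreover have "T powr (a + b - 2) = T powr (a - 1) * T powr (b - 1)"
        by (simp flip: powr_add)
      ultimately show ?thesis
        using that assms by (simp add: powr_mult)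
    qed
    moreover have "T * s \<le> T \<longleftrightarrow> s \<le> 1" using assms by simp
    ultimately show "ennreal ((0 + T * s) powr (a - 1) * (T - (0 + T * s)) powr (b - 1)) * indicator {0..T} (0 + T * s)
      = ennreal (T powr (a + b - 2)) * (ennreal (s powr (a - 1) * (1 - s) powr (b - 1)) * indicator {0..1} s)"
      using assms by (auto simp: indicator_def zero_le_mult_iff simp flip: ennreal_mult)
  qed
  also have "\<dots> = ennreal T * (ennreal (T powr (a + b - 2)) * ennreal (Beta a b))"
    using assms by (subst nn_integral_cmult) (auto simp: unit)
  also have "\<dots> = ennreal (T powr (a + b - 1) * Beta a b)"
  proof -
    have "T * T powr (a + b - 2) = T powr (a + b - 1)"
      using assms powr_add[of T 1 "a + b - 2"] by (simp add: add.commute)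
    moreover have "Beta a b \<ge> 0" using assms by (simp add: Beta_def Gamma_real_pos less_imp_le)
    ultimately show ?thesis
      using assms by (simp add: ennreal_mult[symmetric] mult.assoc[symmetric])
  qed
  finally show ?thesis .
qed

text \<open>By symmetry the integral is twice the one over (0, R), and the substitution v = u^2
  makes it a Beta integral over [0, R^2] with parameters i + 1/2 and \<beta>.\<close>

lemma nn_integral_even_beta:
  fixes R \<beta> :: real
  assumes "R > 0" "\<beta> > 0"
  shows "(\<integral>\<^sup>+u. ennreal (u ^ (2 * i) * (R\<^sup>2 - u\<^sup>2) powr (\<beta> - 1)) * indicator {-R<..<R} u \<partial>lborel)
     = ennreal (R powr (2 * real i + 2 * \<beta> - 1) * Beta (real i + 1/2) \<beta>)"
proof -
  let ?f = "\<lambda>u. ennreal (u ^ (2 * i) * (R\<^sup>2 - u\<^sup>2) powr (\<beta> - 1))"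
  have half: "(\<integral>\<^sup>+u. ?f u * indicator {-R<..<0} u \<partial>lborel) = (\<integral>\<^sup>+u. ?f u * indicator {0<..<R} u \<partial>lborel)"
    by (subst nn_integral_real_affine[where c="-1" and t=0])
       (auto intro!: nn_integral_cong simp: indicator_def)
  have "(\<integral>\<^sup>+u. ?f u * indicator {-R<..<R} u \<partial>lborel)
     = (\<integral>\<^sup>+u. ?f u * indicator {-R<..<0} u + ?f u * indicator {0<..<R} u \<partial>lborel)"
    using AE_lborel_singleton[of "0::real"] assms
    by (intro nn_integral_cong_AE) (auto elim!: eventually_mono simp: indicator_def)
  also have "\<dots> = (\<integral>\<^sup>+u. ?f u * indicator {-R<..<0} u \<partial>lborel) + (\<integral>\<^sup>+u. ?f u * indicator {0<..<R} u \<partial>lborel)"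
    by (rule nn_integral_add) auto
  also have "\<dots> = 2 * (\<integral>\<^sup>+u. ?f u * indicator {0<..<R} u \<partial>lborel)"
    by (simp only: half) (rule mult_2[symmetric])
  also have "\<dots> = (\<integral>\<^sup>+u. 2 * (?f u * indicator {0<..<R} u) \<partial>lborel)"
    by (rule nn_integral_cmult[symmetric]) measurable
  also have "\<dots> = (\<integral>\<^sup>+u. ennreal ((u\<^sup>2) powr (real i + 1/2 - 1) * (R\<^sup>2 - u\<^sup>2) powr (\<beta> - 1)) * (2 * u) * indicator {0..R} u \<partial>lborel)"
  proof (rule nn_integral_cong)
    fix u :: real
    \<comment> \<open>One factor u is split off: together with the 2 from the symmetry it is the
      derivative 2u of u^2.\<close>
    have "u ^ (2 * i) = (u\<^sup>2) powr (real i + 1/2 - 1) * u" if "u > 0"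
    proof -
      have "(u\<^sup>2) powr (real i + 1/2 - 1) * u = u powr (2 * real i - 1) * u powr 1"
        using that powr_powr[of u 2 "real i + 1/2 - 1"] by (simp add: algebra_simps)
      also have "\<dots> = u powr real (2 * i)"
        using that powr_add[of u "2 * real i - 1" 1] by simp
      finally show ?thesis using that by (simp only: powr_realpow)
    qed
    then show "2 * (?f u * indicator {0<..<R} u) =
        ennreal ((u\<^sup>2) powr (real i + 1/2 - 1) * (R\<^sup>2 - u\<^sup>2) powr (\<beta> - 1)) * (2 * u) * indicator {0..R} u"
      by (auto simp: indicator_def ennreal_mult' ennreal_mult'' mult_ac)
  qed
  also have "\<dots> = (\<integral>\<^sup>+v. ennreal (v powr (real i + 1/2 - 1) * (R\<^sup>2 - v) powr (\<beta> - 1)) * indicator {0\<^sup>2..R\<^sup>2} v \<partial>lborel)"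
  proof -
    have "(\<integral>\<^sup>+v. ennreal (v powr (real i + 1/2 - 1) * (R\<^sup>2 - v) powr (\<beta> - 1)) * indicator {0\<^sup>2..R\<^sup>2} v \<partial>lborel)
       = (\<integral>\<^sup>+u. ennreal ((u\<^sup>2) powr (real i + 1/2 - 1) * (R\<^sup>2 - u\<^sup>2) powr (\<beta> - 1)) * ennreal (2 * u) * indicator {0..R} u \<partial>lborel)"
      using assms
      by (intro nn_integral_substitution_aux[where g="\<lambda>u. u\<^sup>2" and g'="\<lambda>u. 2 * u"])
         (auto intro!: derivative_eq_intros continuous_intros)
    then show ?thesis by simp
  qed
  also have "\<dots> = ennreal ((R\<^sup>2) powr (real i + 1/2 + \<beta> - 1) * Beta (real i + 1/2) \<beta>)"
    using nn_integral_beta[of "real i + 1/2" \<beta> "R\<^sup>2"] assms by simp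
  also have "(R\<^sup>2) powr (real i + 1/2 + \<beta> - 1) = R powr (2 * real i + 2 * \<beta> - 1)"
    using assms powr_powr[of R 2 "real i + 1/2 + \<beta> - 1"] by (simp add: algebra_simps)
  finally show ?thesis .
qed

lemma binomial_fact_sum:
  fixes x y :: real
  shows "(\<Sum>i\<le>N. x ^ i / fact i * (y ^ (N - i) / fact (N - i))) = (x + y) ^ N / fact N"
proof -
  have "(x + y) ^ N / fact N = (\<Sum>i\<le>N. of_nat (N choose i) * x ^ i * y ^ (N - i) / fact N)"
    by (simp add: binomial_ring sum_divide_distrib)
  also have "\<dots> = (\<Sum>i\<le>N. x ^ i / fact i * (y ^ (N - i) / fact (N - i)))"
    by (intro sum.cong refl) (simp add: binomial_fact field_simps)
  finally show ?thesis by simp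
qed

text \<open>Integrating out one coordinate of a ball, or one angle of a sphere, raises the parameter
  of $_0F_1$ by one half.\<close>

lemma hyp01_slice:
  fixes b R x y :: real
  assumes b: "b > 0" and R: "R > 0" and y: "y \<ge> 0"
  shows "(\<integral>\<^sup>+u. ennreal ((R\<^sup>2 - u\<^sup>2) powr (b - 1) * exp (x * u)) * hyp01 b (y * (R\<^sup>2 - u\<^sup>2))
            * indicator {-R<..<R} u \<partial>lborel)
     = ennreal (sqrt pi * Gamma b / Gamma (b + 1/2) * R powr (2 * b - 1)) * hyp01 (b + 1/2) (R\<^sup>2 * (y + x\<^sup>2 / 4))"
    (is "?I x = ?rhs")
proof -
  \<comment> \<open>\<open>F\<close> is even. Adding the integral to its reflection turns the
    exponential into 2 cosh(xu), whose series has even powers of u only; the factor 2 is cancelled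
    afterwards.\<close>
  define F where "F u = ennreal ((R\<^sup>2 - u\<^sup>2) powr (b - 1)) * hyp01 b (y * (R\<^sup>2 - u\<^sup>2)) * indicator {-R<..<R} u" for u
  have [measurable]: "F \<in> borel_measurable borel"
    unfolding F_def by measurable
  have IF: "?I x = (\<integral>\<^sup>+u. F u * ennreal (exp (x * u)) \<partial>lborel)" for x
    by (simp add: F_def ennreal_mult mult_ac)
  have "?I x = (\<integral>\<^sup>+u. F u * ennreal (exp (- x * u)) \<partial>lborel)"
    unfolding IF
    by (subst nn_integral_real_affine[where c="-1" and t=0])
       (auto intro!: nn_integral_cong simp: F_def indicator_def)
  then have "2 * ?I x = (\<integral>\<^sup>+u. F u * ennreal (exp (x * u)) + F u * ennreal (exp (- x * u)) \<partial>lborel)"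
    unfolding mult_2 by (subst nn_integral_add) (measurable, simp only: IF)
  also have "\<dots> = (\<integral>\<^sup>+u. 2 * (F u * hyp01 (1/2) ((x * u)\<^sup>2 / 4)) \<partial>lborel)"
  proof (rule nn_integral_cong)
    fix u :: real
    have "ennreal (exp (x * u)) + ennreal (exp (- x * u)) = 2 * ennreal (cosh (x * u))"
      by (simp add: cosh_def flip: ennreal_plus ennreal_numeral ennreal_mult)
    then show "F u * ennreal (exp (x * u)) + F u * ennreal (exp (- x * u)) = 2 * (F u * hyp01 (1/2) ((x * u)\<^sup>2 / 4))"
      unfolding hyp01_half by (simp add: mult.left_commute flip: distrib_left)
  qed
  also have "\<dots> = 2 * (\<integral>\<^sup>+u. F u * hyp01 (1/2) ((x * u)\<^sup>2 / 4) \<partial>lborel)"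
    by (rule nn_integral_cmult) measurable
  finally have "?I x = (\<integral>\<^sup>+u. F u * hyp01 (1/2) ((x * u)\<^sup>2 / 4) \<partial>lborel)"
    by (simp add: ennreal_mult_cancel_left)
  also have "\<dots> = (\<integral>\<^sup>+u. (\<Sum>i. \<Sum>k. ennreal ((x\<^sup>2 / 4) ^ i / (fact i * pochhammer (1/2) i) * (y ^ k / (fact k * pochhammer b k)))
        * (ennreal (u ^ (2 * i) * (R\<^sup>2 - u\<^sup>2) powr (b + real k - 1)) * indicator {-R<..<R} u)) \<partial>lborel)"
  proof (rule nn_integral_cong)
    fix u :: real
    show "F u * hyp01 (1/2) ((x * u)\<^sup>2 / 4) = (\<Sum>i. \<Sum>k. ennreal ((x\<^sup>2 / 4) ^ i / (fact i * pochhammer (1/2) i) * (y ^ k / (fact k * pochhammer b k)))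
        * (ennreal (u ^ (2 * i) * (R\<^sup>2 - u\<^sup>2) powr (b + real k - 1)) * indicator {-R<..<R} u))"
    proof (cases "u \<in> {-R<..<R}")
      case True
      then have pos: "R\<^sup>2 - u\<^sup>2 > 0"
        using abs_le_square_iff[of R u] R by auto
      have "F u * hyp01 (1/2) ((x * u)\<^sup>2 / 4)
        = (\<Sum>i. \<Sum>k. ennreal ((R\<^sup>2 - u\<^sup>2) powr (b - 1)) *
            (ennreal (((x * u)\<^sup>2 / 4) ^ i / (fact i * pochhammer (1/2) i)) * ennreal ((y * (R\<^sup>2 - u\<^sup>2)) ^ k / (fact k * pochhammer b k))))"
        using True unfolding F_def hyp01_def by (simp add: mult_ac)
      also have "\<dots> = (\<Sum>i. \<Sum>k. ennreal ((x\<^sup>2 / 4) ^ i / (fact i * pochhammer (1/2) i) * (y ^ k / (fact k * pochhammer b k)))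
        * (ennreal (u ^ (2 * i) * (R\<^sup>2 - u\<^sup>2) powr (b + real k - 1)) * indicator {-R<..<R} u))"
      proof (intro suminf_cong)
        fix i k
        have pw: "(R\<^sup>2 - u\<^sup>2) powr (b + real k - 1) = (R\<^sup>2 - u\<^sup>2) powr (b - 1) * (R\<^sup>2 - u\<^sup>2) ^ k"
          using powr_add_nat[OF pos, of "b - 1" k] by (simp add: algebra_simps)
        have p: "pochhammer (1/2::real) i > 0" "pochhammer b k > 0"
          using b by (auto intro: pochhammer_pos)
        have nn: "0 \<le> u ^ (2 * i)" by (simp add: power_mult)
        show "ennreal ((R\<^sup>2 - u\<^sup>2) powr (b - 1)) *
            (ennreal (((x * u)\<^sup>2 / 4) ^ i / (fact i * pochhammer (1/2) i)) * ennreal ((y * (R\<^sup>2 - u\<^sup>2)) ^ k / (fact k * pochhammer b k)))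
          = ennreal ((x\<^sup>2 / 4) ^ i / (fact i * pochhammer (1/2) i) * (y ^ k / (fact k * pochhammer b k)))
        * (ennreal (u ^ (2 * i) * (R\<^sup>2 - u\<^sup>2) powr (b + real k - 1)) * indicator {-R<..<R} u)"
          using True p pos y nn unfolding pw
          by (simp flip: ennreal_mult) (simp add: power_mult_distrib power_divide power_mult)
      qed
      finally show ?thesis .
    qed (simp add: F_def)
  qed
  also have "\<dots> = (\<Sum>i. \<Sum>k. ennreal ((x\<^sup>2 / 4) ^ i / (fact i * pochhammer (1/2) i) * (y ^ k / (fact k * pochhammer b k)))
        * ennreal (R powr (2 * real i + 2 * (b + real k) - 1) * Beta (real i + 1/2) (b + real k)))"
    using b R by (simp add: nn_integral_suminf nn_integral_cmult nn_integral_even_beta)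
  also have "\<dots> = (\<Sum>i. \<Sum>k. ennreal (sqrt pi * Gamma b / Gamma (b + 1/2) * R powr (2 * b - 1)) *
       ennreal (((R\<^sup>2 * (x\<^sup>2 / 4)) ^ i / fact i * ((R\<^sup>2 * y) ^ k / fact k)) / pochhammer (b + 1/2) (i + k)))"
  proof (intro suminf_cong)
    fix i k
    have p: "pochhammer (1/2::real) i > 0" "pochhammer b k > 0" "pochhammer (b + 1/2) (i + k) > 0"
      using b by (auto intro: pochhammer_pos)
    have G: "Gamma b > 0" "Gamma (b + 1/2) > 0"
      using b by (auto intro: Gamma_real_pos)
    \<comment> \<open>The two arguments add up to b + 1/2 + (i + k), so the new denominator depends
      on i + k only, while \<open>pochhammer (1/2) i\<close> and \<open>pochhammer b k\<close>
      cancel against the coefficients of the two series. What remains on each antidiagonal is a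
      binomial sum, which merges the two arguments into y + x^2/4.\<close>
    have B: "Beta (real i + 1/2) (b + real k)
      = sqrt pi * Gamma b / Gamma (b + 1/2) * (pochhammer (1/2) i * pochhammer b k / pochhammer (b + 1/2) (i + k))"
    proof -
      have "real i + 1/2 + (b + real k) = b + 1/2 + real (i + k)" by simp
      moreover have "Gamma (real i + 1/2) = pochhammer (1/2) i * sqrt pi"
        using Gamma_shift[of "1/2" i] by (simp add: add.commute Gamma_one_half_real)
      ultimately show ?thesis
        using b Gamma_shift[of b k] Gamma_shift[of "b + 1/2" "i + k"] by (simp only: Beta_def) (simp add: mult_ac)
    qed
    have pw: "R powr (2 * real i + 2 * (b + real k) - 1) = R powr (2 * b - 1) * ((R\<^sup>2) ^ i * (R\<^sup>2) ^ k)"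
    proof -
      have "2 * real i + 2 * (b + real k) - 1 = 2 * b - 1 + real (2 * (i + k))" by simp
      then show ?thesis by (simp only: powr_add_nat[OF R] power_mult power_add)
    qed
    have "(x\<^sup>2 / 4) ^ i / (fact i * pochhammer (1/2) i) * (y ^ k / (fact k * pochhammer b k)) *
        (R powr (2 * real i + 2 * (b + real k) - 1) * Beta (real i + 1/2) (b + real k))
      = sqrt pi * Gamma b / Gamma (b + 1/2) * R powr (2 * b - 1) *
       (((R\<^sup>2 * (x\<^sup>2 / 4)) ^ i / fact i * ((R\<^sup>2 * y) ^ k / fact k)) / pochhammer (b + 1/2) (i + k))"
      unfolding B pw power_mult_distrib using p G by (simp add: mult_ac)
    then show "ennreal ((x\<^sup>2 / 4) ^ i / (fact i * pochhammer (1/2) i) * (y ^ k / (fact k * pochhammer b k)))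
        * ennreal (R powr (2 * real i + 2 * (b + real k) - 1) * Beta (real i + 1/2) (b + real k))
      = ennreal (sqrt pi * Gamma b / Gamma (b + 1/2) * R powr (2 * b - 1)) *
       ennreal (((R\<^sup>2 * (x\<^sup>2 / 4)) ^ i / fact i * ((R\<^sup>2 * y) ^ k / fact k)) / pochhammer (b + 1/2) (i + k))"
      using p G y by (subst (1 2) ennreal_mult[symmetric]) (auto simp: B)
  qed
  also have "\<dots> = ?rhs"
  proof -
    have *: "(\<Sum>i\<le>N. ennreal (((R\<^sup>2 * (x\<^sup>2 / 4)) ^ i / fact i * ((R\<^sup>2 * y) ^ (N - i) / fact (N - i))) / pochhammer (b + 1/2) (i + (N - i))))
      = ennreal ((R\<^sup>2 * (y + x\<^sup>2 / 4)) ^ N / (fact N * pochhammer (b + 1/2) N))" for N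
    proof -
      have p: "pochhammer (b + 1/2) N > 0"
        using b by (auto intro: pochhammer_pos)
      have "(\<Sum>i\<le>N. ennreal (((R\<^sup>2 * (x\<^sup>2 / 4)) ^ i / fact i * ((R\<^sup>2 * y) ^ (N - i) / fact (N - i))) / pochhammer (b + 1/2) (i + (N - i))))
        = (\<Sum>i\<le>N. ennreal (((R\<^sup>2 * (x\<^sup>2 / 4)) ^ i / fact i * ((R\<^sup>2 * y) ^ (N - i) / fact (N - i))) / pochhammer (b + 1/2) N))"
        by (intro sum.cong) auto
      also have "\<dots> = ennreal (\<Sum>i\<le>N. ((R\<^sup>2 * (x\<^sup>2 / 4)) ^ i / fact i * ((R\<^sup>2 * y) ^ (N - i) / fact (N - i))) / pochhammer (b + 1/2) N)"
        using p y by (intro sum_ennreal) auto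
      also have "(\<Sum>i\<le>N. ((R\<^sup>2 * (x\<^sup>2 / 4)) ^ i / fact i * ((R\<^sup>2 * y) ^ (N - i) / fact (N - i))) / pochhammer (b + 1/2) N)
        = (R\<^sup>2 * (y + x\<^sup>2 / 4)) ^ N / (fact N * pochhammer (b + 1/2) N)"
        unfolding sum_divide_distrib[symmetric] binomial_fact_sum by (simp add: algebra_simps)
      finally show ?thesis .
    qed
    show ?thesis
      unfolding hyp01_def *[symmetric]
      by (simp only: ennreal_suminf_cmult suminf_suminf_ennreal_triangle)
  qed
  finally show ?thesis .
qed

text \<open>Both series are integrated term by term. The term (i, k) is a Beta integral with
  parameters a + 2i and b + 2k, which is Beta a b times (a)_{2i} (b)_{2k} / (a+b)_{2(i+k)}. The
  power of \<kappa> T^2 and the last denominator depend on N = i + k only, so the claim reduces to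
  \<open>coeff\<close> for each N.\<close>

lemma hyp01_convolution:
  fixes a b qa qb qc T \<kappa> :: real
  assumes pos: "a > 0" "b > 0" "qa > 0" "qb > 0" "qc > 0" "T > 0" and \<kappa>: "\<kappa> \<ge> 0"
    and coeff: "\<And>N. (\<Sum>i\<le>N. pochhammer a (2 * i) / (fact i * pochhammer qa i) *
                (pochhammer b (2 * (N - i)) / (fact (N - i) * pochhammer qb (N - i))))
              = pochhammer (a + b) (2 * N) / (fact N * pochhammer qc N)"
  shows "(\<integral>\<^sup>+s. ennreal (s powr (a - 1)) * hyp01 qa (\<kappa> * s\<^sup>2) *
            (ennreal ((T - s) powr (b - 1)) * hyp01 qb (\<kappa> * (T - s)\<^sup>2)) * indicator {0<..<T} s \<partial>lborel)
     = ennreal (Beta a b * T powr (a + b - 1)) * hyp01 qc (\<kappa> * T\<^sup>2)" (is "?I = ?rhs")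
proof -
  let ?c = "\<lambda>i k. \<kappa> ^ i / (fact i * pochhammer qa i) * (\<kappa> ^ k / (fact k * pochhammer qb k))"
  have "?I = (\<integral>\<^sup>+s. (\<Sum>i. \<Sum>k. ennreal (?c i k) *
      (ennreal (s powr (a + real (2 * i) - 1) * (T - s) powr (b + real (2 * k) - 1)) * indicator {0..T} s)) \<partial>lborel)"
  proof (rule nn_integral_cong)
    fix s :: real
    show "ennreal (s powr (a - 1)) * hyp01 qa (\<kappa> * s\<^sup>2) *
            (ennreal ((T - s) powr (b - 1)) * hyp01 qb (\<kappa> * (T - s)\<^sup>2)) * indicator {0<..<T} s
      = (\<Sum>i. \<Sum>k. ennreal (?c i k) *
      (ennreal (s powr (a + real (2 * i) - 1) * (T - s) powr (b + real (2 * k) - 1)) * indicator {0..T} s))"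
    proof (cases "s \<in> {0<..<T}")
      case True
      have "ennreal (s powr (a - 1)) * hyp01 qa (\<kappa> * s\<^sup>2) *
            (ennreal ((T - s) powr (b - 1)) * hyp01 qb (\<kappa> * (T - s)\<^sup>2)) * indicator {0<..<T} s
        = (\<Sum>i. \<Sum>k. ennreal (s powr (a - 1)) * ennreal ((T - s) powr (b - 1)) *
            (ennreal ((\<kappa> * s\<^sup>2) ^ i / (fact i * pochhammer qa i)) * ennreal ((\<kappa> * (T - s)\<^sup>2) ^ k / (fact k * pochhammer qb k))))"
        using True unfolding hyp01_def by (simp add: mult_ac)
      also have "\<dots> = (\<Sum>i. \<Sum>k. ennreal (?c i k) *
      (ennreal (s powr (a + real (2 * i) - 1) * (T - s) powr (b + real (2 * k) - 1)) * indicator {0..T} s))"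
      proof (intro suminf_cong)
        fix i k
        have pw: "u powr (e + real (2 * j) - 1) = u powr (e - 1) * (u\<^sup>2) ^ j" if "u > 0" for u e :: real and j
        proof -
          have "e + real (2 * j) - 1 = e - 1 + real (2 * j)" by simp
          then show ?thesis by (simp only: powr_add_nat[OF that] power_mult)
        qed
        have pw': "s powr (a + real (2 * i) - 1) = s powr (a - 1) * (s\<^sup>2) ^ i"
          "(T - s) powr (b + real (2 * k) - 1) = (T - s) powr (b - 1) * ((T - s)\<^sup>2) ^ k"
          using True pw[of s a i] pw[of "T - s" b k] by simp_all
        have p: "pochhammer qa i > 0" "pochhammer qb k > 0"
          using pos by (auto intro: pochhammer_pos)
        show "ennreal (s powr (a - 1)) * ennreal ((T - s) powr (b - 1)) *
            (ennreal ((\<kappa> * s\<^sup>2) ^ i / (fact i * pochhammer qa i)) * ennreal ((\<kappa> * (T - s)\<^sup>2) ^ k / (fact k * pochhammer qb k)))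
          = ennreal (?c i k) *
      (ennreal (s powr (a + real (2 * i) - 1) * (T - s) powr (b + real (2 * k) - 1)) * indicator {0..T} s)"
          using True p \<kappa> unfolding pw'
          by (simp flip: ennreal_mult) (simp add: power_mult_distrib)
      qed
      finally show ?thesis .
    next
      case False
      \<comment> \<open>At s = 0 and s = T one of the two bases is 0, and
        \<open>0 powr e = 0\<close> for every e. The open interval of the claim may thus be
        exchanged for the closed one of the Beta integral without an almost-everywhere
        argument.\<close>
      then have "s powr (a + real (2 * i) - 1) * (T - s) powr (b + real (2 * k) - 1) * indicator {0..T} s = 0" for i k
        by (auto simp: indicator_def)
      with False have *: "ennreal (s powr (a + real (2 * i) - 1) * (T - s) powr (b + real (2 * k) - 1)) * indicator {0..T} s = 0" for i k
        by (auto simp: indicator_def)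
      show ?thesis using False by (simp only: *) simp
    qed
  qed
  also have "\<dots> = (\<Sum>i. \<Sum>k. ennreal (?c i k) *
      ennreal (T powr (a + real (2 * i) + (b + real (2 * k)) - 1) * Beta (a + real (2 * i)) (b + real (2 * k))))"
  proof -
    define g where "g i k s = ennreal (s powr (a + real (2 * i) - 1) * (T - s) powr (b + real (2 * k) - 1)) * indicator {0..T} s"
      for i k s
    have [measurable]: "g i k \<in> borel_measurable borel" for i k
      unfolding g_def by measurable
    have beta: "(\<integral>\<^sup>+s. g i k s \<partial>lborel)
      = ennreal (T powr (a + real (2 * i) + (b + real (2 * k)) - 1) * Beta (a + real (2 * i)) (b + real (2 * k)))" for i k
      unfolding g_def by (rule nn_integral_beta) (use pos in auto)
    have "(\<integral>\<^sup>+s. (\<Sum>i. \<Sum>k. ennreal (?c i k) * g i k s) \<partial>lborel)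
      = (\<Sum>i. \<integral>\<^sup>+s. (\<Sum>k. ennreal (?c i k) * g i k s) \<partial>lborel)"
      by (rule nn_integral_suminf) measurable
    also have "\<dots> = (\<Sum>i. \<Sum>k. \<integral>\<^sup>+s. ennreal (?c i k) * g i k s \<partial>lborel)"
      by (intro suminf_cong nn_integral_suminf) measurable
    also have "\<dots> = (\<Sum>i. \<Sum>k. ennreal (?c i k) * (\<integral>\<^sup>+s. g i k s \<partial>lborel))"
      by (intro suminf_cong nn_integral_cmult) measurable
    finally show ?thesis
      by (simp only: beta) (simp only: g_def)
  qed
  also have "\<dots> = (\<Sum>i. \<Sum>k. ennreal (Beta a b * T powr (a + b - 1)) *
       ennreal ((\<kappa> * T\<^sup>2) ^ (i + k) / pochhammer (a + b) (2 * (i + k)) *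
         (pochhammer a (2 * i) / (fact i * pochhammer qa i) * (pochhammer b (2 * k) / (fact k * pochhammer qb k)))))"
  proof (intro suminf_cong)
    fix i k
    have p: "pochhammer qa i > 0" "pochhammer qb k > 0" "pochhammer (a + b) (2 * (i + k)) > 0"
       "pochhammer a (2 * i) > 0" "pochhammer b (2 * k) > 0"
      using pos by (auto intro: pochhammer_pos)
    have G: "Gamma a > 0" "Gamma b > 0" "Gamma (a + b) > 0"
      using pos by (auto intro: Gamma_real_pos)
    have B: "Beta (a + real (2 * i)) (b + real (2 * k))
      = Beta a b * (pochhammer a (2 * i) * pochhammer b (2 * k) / pochhammer (a + b) (2 * (i + k)))"
    proof -
      have "a + real (2 * i) + (b + real (2 * k)) = a + b + real (2 * (i + k))" by simp
      then show ?thesis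
        unfolding Beta_def using pos Gamma_shift[of a "2 * i"] Gamma_shift[of b "2 * k"] Gamma_shift[of "a + b" "2 * (i + k)"]
        by (simp only:) (simp add: mult_ac)
    qed
    have Bpos: "Beta a b > 0" using G by (simp add: Beta_def)
    have pw: "T powr (a + real (2 * i) + (b + real (2 * k)) - 1) = T powr (a + b - 1) * (T\<^sup>2) ^ (i + k)"
    proof -
      have "a + real (2 * i) + (b + real (2 * k)) - 1 = a + b - 1 + real (2 * (i + k))" by simp
      then show ?thesis using pos by (simp only: powr_add_nat power_mult)
    qed
    have "?c i k * (T powr (a + real (2 * i) + (b + real (2 * k)) - 1) * Beta (a + real (2 * i)) (b + real (2 * k)))
     = Beta a b * T powr (a + b - 1) * ((\<kappa> * T\<^sup>2) ^ (i + k) / pochhammer (a + b) (2 * (i + k)) *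
         (pochhammer a (2 * i) / (fact i * pochhammer qa i) * (pochhammer b (2 * k) / (fact k * pochhammer qb k))))"
      unfolding B pw by (simp add: power_mult_distrib power_add mult_ac)
    moreover have "Beta (a + real (2 * i)) (b + real (2 * k)) \<ge> 0"
      unfolding B using p Bpos by simp
    ultimately show "ennreal (?c i k) *
      ennreal (T powr (a + real (2 * i) + (b + real (2 * k)) - 1) * Beta (a + real (2 * i)) (b + real (2 * k)))
      = ennreal (Beta a b * T powr (a + b - 1)) *
       ennreal ((\<kappa> * T\<^sup>2) ^ (i + k) / pochhammer (a + b) (2 * (i + k)) *
         (pochhammer a (2 * i) / (fact i * pochhammer qa i) * (pochhammer b (2 * k) / (fact k * pochhammer qb k))))"
      using p \<kappa> Bpos by (subst (1 2) ennreal_mult[symmetric]) auto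
  qed
  also have "\<dots> = ?rhs"
  proof -
    have *: "(\<Sum>i\<le>N. ennreal ((\<kappa> * T\<^sup>2) ^ (i + (N - i)) / pochhammer (a + b) (2 * (i + (N - i))) *
         (pochhammer a (2 * i) / (fact i * pochhammer qa i) * (pochhammer b (2 * (N - i)) / (fact (N - i) * pochhammer qb (N - i))))))
      = ennreal ((\<kappa> * T\<^sup>2) ^ N / (fact N * pochhammer qc N))" for N
    proof -
      have p: "pochhammer qa i > 0" "pochhammer qb i > 0" "pochhammer (a + b) i > 0"
        "pochhammer a i > 0" "pochhammer b i > 0" for i
        using pos by (auto intro: pochhammer_pos)
      have "(\<Sum>i\<le>N. ennreal ((\<kappa> * T\<^sup>2) ^ (i + (N - i)) / pochhammer (a + b) (2 * (i + (N - i))) *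
         (pochhammer a (2 * i) / (fact i * pochhammer qa i) * (pochhammer b (2 * (N - i)) / (fact (N - i) * pochhammer qb (N - i))))))
       = (\<Sum>i\<le>N. ennreal ((\<kappa> * T\<^sup>2) ^ N / pochhammer (a + b) (2 * N) *
         (pochhammer a (2 * i) / (fact i * pochhammer qa i) * (pochhammer b (2 * (N - i)) / (fact (N - i) * pochhammer qb (N - i))))))"
        by (intro sum.cong) auto
      also have "\<dots> = ennreal (\<Sum>i\<le>N. (\<kappa> * T\<^sup>2) ^ N / pochhammer (a + b) (2 * N) *
         (pochhammer a (2 * i) / (fact i * pochhammer qa i) * (pochhammer b (2 * (N - i)) / (fact (N - i) * pochhammer qb (N - i)))))"
        using p \<kappa> by (intro sum_ennreal) (simp add: less_imp_le)
      also have "(\<Sum>i\<le>N. (\<kappa> * T\<^sup>2) ^ N / pochhammer (a + b) (2 * N) *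
         (pochhammer a (2 * i) / (fact i * pochhammer qa i) * (pochhammer b (2 * (N - i)) / (fact (N - i) * pochhammer qb (N - i)))))
         = (\<kappa> * T\<^sup>2) ^ N / (fact N * pochhammer qc N)"
        unfolding sum_distrib_left[symmetric] coeff using p[of "2 * N"] by simp
      finally show ?thesis .
    qed
    show ?thesis
      unfolding hyp01_def *[symmetric]
      by (simp only: ennreal_suminf_cmult suminf_suminf_ennreal_triangle)
  qed
  finally show ?thesis .
qed

subsection \<open>Measures determined by their moment generating function\<close>

text \<open>Lower orthants are closed under intersection, which makes them the generator for the
  uniqueness of measures below. They generate because a half-space x_i \<le> a is the increasing
  union of the orthants whose other bounds are n.\<close>

lemma sets_PiM_atMost:
  fixes I :: "'i set"
  assumes I: "finite I"
  shows "sets (PiM I (\<lambda>_. borel :: real measure)) = sigma_sets (\<Pi>\<^sub>E i\<in>I. UNIV) (range (\<lambda>a. \<Pi>\<^sub>E i\<in>I. {..a i}))"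
    (is "_ = sigma_sets ?\<Omega> ?E")
proof (rule antisym)
  have E: "?E \<subseteq> Pow ?\<Omega>" by (auto simp: PiE_def)
  show "sigma_sets ?\<Omega> ?E \<subseteq> sets (PiM I (\<lambda>_. borel :: real measure))"
  proof -
    have "sigma_sets (space (PiM I (\<lambda>_. borel :: real measure))) ?E \<subseteq> sets (PiM I (\<lambda>_. borel :: real measure))"
      using I by (intro sets.sigma_sets_subset) (auto intro!: sets_PiM_I_finite)
    then show ?thesis by (simp add: space_PiM)
  qed
  let ?N = "sigma ?\<Omega> ?E"
  have "sets (PiM I (\<lambda>_. borel :: real measure)) \<subseteq> sets ?N"
  proof (rule sets_PiM_in_sets)
    show "space ?N = (\<Pi>\<^sub>E i\<in>I. space (borel :: real measure))"
      by (simp add: space_measure_of_conv)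
    fix i and A :: "real set" assume i: "i \<in> I" and A: "A \<in> sets borel"
    have "(\<lambda>x. x i) \<in> borel_measurable ?N"
    proof (rule borel_measurableI_le)
      fix a :: real
      have "{x \<in> space ?N. x i \<le> a} = (\<Union>n::nat. \<Pi>\<^sub>E j\<in>I. {..if j = i then a else real n})"
      proof safe
        fix x assume x: "x \<in> space ?N" "x i \<le> a"
        obtain n :: nat where n: "Max (x ` I) \<le> real n"
          using real_arch_simple by blast
        have "x j \<le> real n" if "j \<in> I" for j
          using n I that by (meson Max_ge finite_imageI imageI order_trans)
        then show "x \<in> (\<Union>n::nat. \<Pi>\<^sub>E j\<in>I. {..if j = i then a else real n})"
          using x by (intro UN_I[of n]) (auto simp: space_measure_of_conv PiE_iff)
      next
        fix x and n :: nat
        assume "x \<in> (\<Pi>\<^sub>E j\<in>I. {..if j = i then a else real n})"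
        then show "x \<in> space ?N" "x i \<le> a"
          using i by (auto simp: space_measure_of_conv PiE_iff split: if_splits)
      qed
      also have "\<dots> \<in> sets ?N"
        using E by (intro sets.countable_UN) (auto simp: sets_measure_of)
      finally show "{x \<in> space ?N. x i \<le> a} \<in> sets ?N" .
    qed
    then show "{x \<in> space ?N. x i \<in> A} \<in> sets ?N"
      using A measurable_sets[of "\<lambda>x. x i" ?N borel A] by (simp add: vimage_def Int_def conj_commute)
  qed
  then show "sets (PiM I (\<lambda>_. borel :: real measure)) \<subseteq> sigma_sets ?\<Omega> ?E"
    using E by (simp add: sets_measure_of)
qed

text \<open>The coefficient is part of the generator, so no rule for scalar multiples is needed.
  Frequencies add under multiplication, hence the span is an algebra; it contains the constants
  (frequency 0), and the coordinate exponentials separate points.\<close>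

inductive exp_span :: "'i set \<Rightarrow> (('i \<Rightarrow> real) \<Rightarrow> real) \<Rightarrow> bool" for I where
  exp: "exp_span I (\<lambda>x. c * exp (\<Sum>i\<in>I. \<xi> i * x i))"
| add: "exp_span I f \<Longrightarrow> exp_span I g \<Longrightarrow> exp_span I (\<lambda>x. f x + g x)"

lemma exp_span_const: "exp_span I (\<lambda>_. c)"
  using exp_span.exp[of I c "\<lambda>_. 0"] by simp

lemma exp_span_mult:
  assumes "exp_span I f" "exp_span I g"
  shows "exp_span I (\<lambda>x. f x * g x)"
  using assms
proof (induction rule: exp_span.induct)
  case (exp c \<xi>)
  from exp show ?case
  proof (induction rule: exp_span.induct)
    case (exp d \<eta>)
    have "(\<lambda>x. c * exp (\<Sum>i\<in>I. \<xi> i * x i) * (d * exp (\<Sum>i\<in>I. \<eta> i * x i)))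
      = (\<lambda>x. (c * d) * exp (\<Sum>i\<in>I. (\<xi> i + \<eta> i) * x i))"
      by (simp add: fun_eq_iff algebra_simps sum.distrib exp_add)
    then show ?case
      using exp_span.exp[of I "c * d" "\<lambda>i. \<xi> i + \<eta> i"] by simp
  next
    case (add f g)
    then show ?case using exp_span.add by (simp add: distrib_left)
  qed
next
  case (add f g)
  then show ?case using exp_span.add by (simp add: distrib_right)
qed

lemma exp_span_continuous_on: "exp_span I f \<Longrightarrow> continuous_on S f"
  by (induction rule: exp_span.induct)
     (auto intro!: continuous_intros continuous_on_product_then_coordinatewise[OF continuous_on_id])

text \<open>The function type carries the product topology over all indices, not just over I.
  Extensional functions are pinned to \<open>undefined\<close> outside I, so the cube is a full
  product with singletons as the remaining factors, and Tychonoff's theorem applies.\<close>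

lemma compact_PiE_real:
  fixes I :: "'i set" and a b :: real
  shows "compact (\<Pi>\<^sub>E i\<in>I. {a..b})"
proof -
  have eq: "(\<Pi>\<^sub>E i\<in>I. {a..b}) = (\<Pi>\<^sub>E i\<in>UNIV. if i \<in> I then {a..b} else {undefined})"
    by (auto simp: PiE_iff extensional_def split: if_splits)
  have "compactin (product_topology (\<lambda>_. euclidean) UNIV) (\<Pi>\<^sub>E i\<in>UNIV. if i \<in> I then {a..b} else {undefined})"
    by (auto simp: compactin_PiE)
  then show ?thesis
    by (simp add: eq euclidean_product_topology flip: compactin_euclidean_iff)
qed

text \<open>Markov's inequality with the weights \<open>exp (r * X)\<close>, \<open>r \<rightarrow> \<infinity>\<close>.\<close>

lemma AE_le_if_mgf_bound:
  fixes X :: "'a \<Rightarrow> real"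
  assumes "finite_measure M" and [measurable]: "X \<in> borel_measurable M"
    and C: "\<And>r. r > 0 \<Longrightarrow> (\<integral>\<^sup>+x. ennreal (exp (r * X x)) \<partial>M) \<le> ennreal (C * exp (r * R))"
  shows "AE x in M. X x \<le> R"
proof -
  interpret finite_measure M by fact
  have zero: "emeasure M {x\<in>space M. X x \<ge> R + e} = 0" if e: "e > 0" for e
  proof (rule ccontr)
    let ?A = "{x\<in>space M. X x \<ge> R + e}"
    assume "emeasure M ?A \<noteq> 0"
    then have p: "measure M ?A > 0"
      by (simp add: emeasure_eq_measure zero_less_measure_iff)
    \<comment> \<open>With p the measure of \<open>?A\<close>, this makes r e p equal to
      \<bar>C\<bar> + 1, whereas the exponential bound forces r e p \<le> exp(re) p \<le>
      \<bar>C\<bar>.\<close>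
    define r where "r = (\<bar>C\<bar> + 1) / (e * measure M ?A)"
    have r: "r > 0" using e p by (simp add: r_def)
    have "ennreal (exp (r * (R + e)) * measure M ?A) = (\<integral>\<^sup>+x. ennreal (exp (r * (R + e))) * indicator ?A x \<partial>M)"
      by (subst nn_integral_cmult_indicator) (auto simp: emeasure_eq_measure ennreal_mult)
    also have "\<dots> \<le> (\<integral>\<^sup>+x. ennreal (exp (r * X x)) \<partial>M)"
      using r by (intro nn_integral_mono) (auto simp: indicator_def)
    also have "\<dots> \<le> ennreal (C * exp (r * R))"
      by (rule C[OF r])
    also have "\<dots> \<le> ennreal (\<bar>C\<bar> * exp (r * R))"
      by (intro ennreal_leI mult_right_mono) auto
    finally have "exp (r * R) * (exp (r * e) * measure M ?A) \<le> exp (r * R) * \<bar>C\<bar>"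
      by (simp add: distrib_left exp_add mult_ac)
    then have "exp (r * e) * measure M ?A \<le> \<bar>C\<bar>"
      by (simp only: mult_le_cancel_left_pos exp_gt_zero)
    moreover have "r * e * measure M ?A \<le> exp (r * e) * measure M ?A"
      using exp_ge_add_one_self[of "r * e"] by (intro mult_right_mono) (linarith, simp)
    moreover have "r * e * measure M ?A = \<bar>C\<bar> + 1"
      using e p by (simp add: r_def)
    ultimately show False by simp
  qed
  have "AE x in M. \<forall>n::nat. \<not> X x \<ge> R + inverse (real (Suc n))"
  proof (subst AE_all_countable, intro allI)
    fix n :: nat
    have "{x\<in>space M. X x \<ge> R + inverse (real (Suc n))} \<in> null_sets M"
      using zero[of "inverse (real (Suc n))"] by (intro null_setsI) auto
    then show "AE x in M. \<not> X x \<ge> R + inverse (real (Suc n))"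
      by (rule AE_I') auto
  qed
  then show ?thesis
  proof eventually_elim
    case (elim x)
    show ?case
    proof (rule ccontr)
      assume "\<not> X x \<le> R"
      then obtain n where "inverse (real (Suc n)) < X x - R"
        using reals_Archimedean[of "X x - R"] by auto
      moreover have "\<not> X x \<ge> R + inverse (real (Suc n))" using elim by blast
      ultimately show False by linarith
    qed
  qed
qed

text \<open>Only \<nu> is assumed to be bounded. The bound passes to \<mu> because the transforms
  agree in the directions of plus and minus each coordinate vector, where
  \<open>AE_le_if_mgf_bound\<close> applies; so the law of the flight never has to be bounded
  directly. Once both measures live on one compact cube, agreement spreads from exponentials to
  continuous functions and from these to orthants.\<close>

theorem measure_eqI_mgf:
  fixes \<mu> \<nu> :: "('i::countable \<Rightarrow> real) measure"
  assumes I: "finite I"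
    and sets_\<mu>: "sets \<mu> = sets (PiM I (\<lambda>_. borel))" and sets_\<nu>: "sets \<nu> = sets (PiM I (\<lambda>_. borel))"
    and "finite_measure \<nu>" and bound: "AE x in \<nu>. \<forall>i\<in>I. \<bar>x i\<bar> \<le> R"
    and mgf: "\<And>\<xi>. (\<integral>\<^sup>+x. ennreal (exp (\<Sum>i\<in>I. \<xi> i * x i)) \<partial>\<mu>) = (\<integral>\<^sup>+x. ennreal (exp (\<Sum>i\<in>I. \<xi> i * x i)) \<partial>\<nu>)"
  shows "\<mu> = \<nu>"
proof -
  interpret \<nu>: finite_measure \<nu> by fact
  note [measurable_cong] = sets_\<mu> sets_\<nu>
  have space: "space \<mu> = (\<Pi>\<^sub>E i\<in>I. UNIV)" "space \<nu> = (\<Pi>\<^sub>E i\<in>I. UNIV)"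
    using sets_eq_imp_space_eq[OF sets_\<mu>] sets_eq_imp_space_eq[OF sets_\<nu>] by (simp_all add: space_PiM)
  have mass: "emeasure \<mu> (space \<mu>) = emeasure \<nu> (space \<nu>)"
    using mgf[of "\<lambda>_. 0"] by simp
  interpret \<mu>: finite_measure \<mu>
    by standard (simp add: mass)
  have one: "(\<Sum>j\<in>I. (if j = i then r else 0) * x j) = r * x i" if "i \<in> I" for i r and x :: "'i \<Rightarrow> real"
    using I that by (simp add: if_distrib[of "\<lambda>t. t * _"] cong: if_cong)
  have side: "AE x in \<mu>. s * x i \<le> R" if i: "i \<in> I" and s: "s \<in> {-1, 1}" for i s
  proof (rule AE_le_if_mgf_bound[OF \<mu>.finite_measure_axioms])
    show "(\<lambda>x. s * x i) \<in> borel_measurable \<mu>"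
      using i by measurable
    fix r :: real assume r: "r > 0"
    have "(\<integral>\<^sup>+x. ennreal (exp (r * (s * x i))) \<partial>\<mu>) = (\<integral>\<^sup>+x. ennreal (exp (r * (s * x i))) \<partial>\<nu>)"
      using mgf[of "\<lambda>j. if j = i then r * s else 0"] i by (simp add: one mult.assoc)
    also have "\<dots> \<le> (\<integral>\<^sup>+x. ennreal (exp (r * R)) \<partial>\<nu>)"
    proof (rule nn_integral_mono_AE)
      show "AE x in \<nu>. ennreal (exp (r * (s * x i))) \<le> ennreal (exp (r * R))"
        using bound
      proof eventually_elim
        case (elim x)
        then have "s * x i \<le> R" using i s by (auto simp: abs_le_iff)
        then show ?case using r by (auto intro!: ennreal_leI)
      qed
    qed
    also have "\<dots> = ennreal (measure \<nu> (space \<nu>) * exp (r * R))"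
      by (simp add: \<nu>.emeasure_eq_measure ennreal_mult mult.commute)
    finally show "(\<integral>\<^sup>+x. ennreal (exp (r * (s * x i))) \<partial>\<mu>) \<le> ennreal (measure \<nu> (space \<nu>) * exp (r * R))" .
  qed
  have bound_\<mu>: "AE x in \<mu>. \<forall>i\<in>I. \<bar>x i\<bar> \<le> R"
  proof (subst AE_finite_all[OF I], intro ballI)
    fix i assume i: "i \<in> I"
    show "AE x in \<mu>. \<bar>x i\<bar> \<le> R"
    proof -
      have "AE x in \<mu>. 1 * x i \<le> R" "AE x in \<mu>. -1 * x i \<le> R"
        using side[OF i] by blast+
      then show ?thesis by eventually_elim auto
    qed
  qed
  define S where "S = (\<Pi>\<^sub>E i\<in>I. {-R..R})"
  have S: "AE x in \<mu>. x \<in> S" "AE x in \<nu>. x \<in> S"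
  proof -
    show "AE x in \<mu>. x \<in> S"
      using bound_\<mu> AE_space by eventually_elim (auto simp: S_def space PiE_iff abs_le_iff)
    show "AE x in \<nu>. x \<in> S"
      using bound AE_space by eventually_elim (auto simp: S_def space PiE_iff abs_le_iff)
  qed
  have compact_S: "compact S"
    unfolding S_def by (rule compact_PiE_real)
  have integrable: "integrable \<mu> f \<and> integrable \<nu> f"
    if f: "continuous_on S f" and [measurable]: "f \<in> borel_measurable (PiM I (\<lambda>_. borel))" for f :: "('i \<Rightarrow> real) \<Rightarrow> real"
  proof -
    have "compact (f ` S)"
      using compact_continuous_image[OF f compact_S] .
    then obtain B where B: "\<And>x. x \<in> S \<Longrightarrow> \<bar>f x\<bar> \<le> B"
      using compact_imp_bounded[of "f ` S"] by (auto simp: bounded_iff)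
    have "AE x in \<mu>. norm (f x) \<le> B" "AE x in \<nu>. norm (f x) \<le> B"
      using S(1) by (eventually_elim, simp add: B) (use S(2) in eventually_elim, simp add: B)
    then show ?thesis
      by (auto intro!: \<mu>.integrable_const_bound \<nu>.integrable_const_bound)
  qed
  have exp_span: "f \<in> borel_measurable (PiM I (\<lambda>_. borel)) \<and> (\<integral>x. f x \<partial>\<mu>) = (\<integral>x. f x \<partial>\<nu>)" if "exp_span I f" for f
    using that
  proof (induction rule: exp_span.induct)
    case (exp c \<xi>)
    have meas [measurable]: "(\<lambda>x. exp (\<Sum>i\<in>I. \<xi> i * x i)) \<in> borel_measurable (PiM I (\<lambda>_. borel))"
      by measurable
    have "(\<integral>x. exp (\<Sum>i\<in>I. \<xi> i * x i) \<partial>\<mu>) = (\<integral>x. exp (\<Sum>i\<in>I. \<xi> i * x i) \<partial>\<nu>)"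
      by (subst (1 2) integral_eq_nn_integral) (auto simp: mgf)
    then show ?case by simp
  next
    case (add f g)
    then show ?case
      using integrable[OF exp_span_continuous_on[OF add.hyps(1)]] integrable[OF exp_span_continuous_on[OF add.hyps(2)]]
      by (auto intro: borel_measurable_add)
  qed
  have Cont: "(\<integral>x. f x \<partial>\<mu>) = (\<integral>x. f x \<partial>\<nu>)"
    if f: "continuous_on S f" and [measurable]: "f \<in> borel_measurable (PiM I (\<lambda>_. borel))" for f :: "('i \<Rightarrow> real) \<Rightarrow> real"
  proof (rule ccontr)
    assume ne: "(\<integral>x. f x \<partial>\<mu>) \<noteq> (\<integral>x. f x \<partial>\<nu>)"
    \<comment> \<open>A uniform error e costs at most e times the common total mass for each
      measure. The summand 1 in the denominator keeps twice that cost strictly below the assumed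
      gap, also when the mass is 0.\<close>
    define e where "e = \<bar>(\<integral>x. f x \<partial>\<mu>) - (\<integral>x. f x \<partial>\<nu>)\<bar> / (2 * measure \<nu> (space \<nu>) + 1)"
    have "2 * measure \<nu> (space \<nu>) + 1 > 0"
      using measure_nonneg[of \<nu> "space \<nu>"] by linarith
    then have e: "e > 0" "e * (2 * measure \<nu> (space \<nu>) + 1) = \<bar>(\<integral>x. f x \<partial>\<mu>) - (\<integral>x. f x \<partial>\<nu>)\<bar>"
      using ne by (auto simp: e_def)
    interpret function_ring_on "Collect (exp_span I)" S
    proof
      show "compact S" by (rule compact_S)
      show "\<exists>f\<in>Collect (exp_span I). f x \<noteq> f y" if xy: "x \<in> S" "y \<in> S" "x \<noteq> y" for x y
      proof -
        obtain i where i: "i \<in> I" "x i \<noteq> y i"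
          using xy unfolding S_def by (metis PiE_ext)
        then show ?thesis
          using exp_span.exp[of I 1 "\<lambda>j. if j = i then 1 else 0"] one[OF i(1), of 1]
          by (intro bexI[of _ "\<lambda>x. 1 * exp (\<Sum>j\<in>I. (if j = i then 1 else 0) * x j)"]) auto
      qed
    qed (auto intro: exp_span_continuous_on exp_span.add exp_span_mult exp_span_const)
    obtain g where g: "exp_span I g" "\<And>x. x \<in> S \<Longrightarrow> \<bar>f x - g x\<bar> < e"
      using Stone_Weierstrass_basic[OF f e(1)] by auto
    have [measurable]: "g \<in> borel_measurable (PiM I (\<lambda>_. borel))" using exp_span[OF g(1)] by simp
    note int = integrable[OF f] integrable[OF exp_span_continuous_on[OF g(1)]]
    have close: "\<bar>(\<integral>x. f x \<partial>L) - (\<integral>x. g x \<partial>L)\<bar> \<le> e * measure \<nu> (space \<nu>)"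
      if L: "finite_measure L" "integrable L f" "integrable L g" "AE x in L. x \<in> S"
        "measure L (space L) = measure \<nu> (space \<nu>)" for L
    proof -
      interpret L: finite_measure L by fact
      have "\<bar>\<integral>x. f x - g x \<partial>L\<bar> \<le> (\<integral>x. \<bar>f x - g x\<bar> \<partial>L)"
        by (rule integral_abs_bound)
      also have "\<dots> \<le> (\<integral>x. e \<partial>L)"
        using L by (intro integral_mono_AE) (auto elim!: eventually_mono dest!: g(2))
      finally show ?thesis
        using L by (simp add: mult.commute)
    qed
    have mass': "measure \<mu> (space \<mu>) = measure \<nu> (space \<nu>)"
      using mass by (simp add: measure_def)
    have "\<bar>(\<integral>x. f x \<partial>\<mu>) - (\<integral>x. f x \<partial>\<nu>)\<bar> \<le> 2 * (e * measure \<nu> (space \<nu>))"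
      using close[of \<mu>] close[of \<nu>] int S mass' exp_span[OF g(1)] \<mu>.finite_measure_axioms \<nu>.finite_measure_axioms
      by auto
    with e show False by (simp add: algebra_simps)
  qed
  show ?thesis
  proof (rule measure_eqI_generator_eq[where \<Omega>="\<Pi>\<^sub>E i\<in>I. UNIV" and E="range (\<lambda>a. \<Pi>\<^sub>E i\<in>I. {..a i})" and A="\<lambda>n. \<Pi>\<^sub>E i\<in>I. {..real n}"])
    show "Int_stable (range (\<lambda>a. \<Pi>\<^sub>E i\<in>I. {..a i::real}))"
    proof (rule Int_stableI, safe)
      fix a b :: "'i \<Rightarrow> real"
      have "(\<Pi>\<^sub>E i\<in>I. {..a i}) \<inter> (\<Pi>\<^sub>E i\<in>I. {..b i}) = (\<Pi>\<^sub>E i\<in>I. {..min (a i) (b i)})"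
        by (auto simp: PiE_iff)
      then show "(\<Pi>\<^sub>E i\<in>I. {..a i}) \<inter> (\<Pi>\<^sub>E i\<in>I. {..b i}) \<in> range (\<lambda>a. \<Pi>\<^sub>E i\<in>I. {..a i})"
        by (metis rangeI)
    qed
    show "range (\<lambda>a. \<Pi>\<^sub>E i\<in>I. {..a i::real}) \<subseteq> Pow (\<Pi>\<^sub>E i\<in>I. UNIV)"
      by (auto simp: PiE_iff)
    show "sets \<mu> = sigma_sets (\<Pi>\<^sub>E i\<in>I. UNIV) (range (\<lambda>a. \<Pi>\<^sub>E i\<in>I. {..a i}))"
      "sets \<nu> = sigma_sets (\<Pi>\<^sub>E i\<in>I. UNIV) (range (\<lambda>a. \<Pi>\<^sub>E i\<in>I. {..a i}))"
      using sets_PiM_atMost[OF I] by (simp_all add: sets_\<mu> sets_\<nu>)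
    show "range (\<lambda>n. \<Pi>\<^sub>E i\<in>I. {..real n}) \<subseteq> range (\<lambda>a. \<Pi>\<^sub>E i\<in>I. {..a i})"
      by auto
    show "(\<Union>n. \<Pi>\<^sub>E i\<in>I. {..real n}) = (\<Pi>\<^sub>E i\<in>I. UNIV)"
    proof safe
      fix x :: "'i \<Rightarrow> real" assume x: "x \<in> (\<Pi>\<^sub>E i\<in>I. UNIV)"
      obtain n :: nat where n: "Max (x ` I) \<le> real n"
        using real_arch_simple by blast
      have "x j \<le> real n" if "j \<in> I" for j
        using n I that by (meson Max_ge finite_imageI imageI order_trans)
      then show "x \<in> (\<Union>n. \<Pi>\<^sub>E i\<in>I. {..real n})"
        using x by (intro UN_I[of n]) (auto simp: PiE_iff)
    qed (auto simp: PiE_iff extensional_def)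
    show "emeasure \<mu> (\<Pi>\<^sub>E i\<in>I. {..real n}) \<noteq> \<infinity>" for n
      by (simp add: \<mu>.emeasure_eq_measure)
    fix X :: "('i \<Rightarrow> real) set" assume "X \<in> range (\<lambda>a. \<Pi>\<^sub>E i\<in>I. {..a i})"
    then obtain a where X: "X = (\<Pi>\<^sub>E i\<in>I. {..a i})" by auto
    have X_sets: "X \<in> sets (PiM I (\<lambda>_. borel))"
      unfolding X using I by (intro sets_PiM_I_finite) auto
    \<comment> \<open>A continuous ramp: 1 for t \<le> 0, falling linearly to 0 at t = 1/k. The
      products \<open>f k\<close> converge pointwise to the indicator of the closed orthant and are
      bounded by 1, so dominated convergence applies.\<close>
    define \<phi> where "\<phi> k t = max 0 (min 1 (1 - real k * t))" for k :: nat and t :: real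
    define f where "f k x = (\<Prod>i\<in>I. \<phi> k (x i - a i))" for k and x :: "'i \<Rightarrow> real"
    have \<phi>_bound: "0 \<le> \<phi> k t" "\<phi> k t \<le> 1" for k t by (auto simp: \<phi>_def)
    have f_meas [measurable]: "f k \<in> borel_measurable (PiM I (\<lambda>_. borel))" for k
      unfolding f_def \<phi>_def by measurable
    have f_cont: "continuous_on S (f k)" for k
      unfolding f_def \<phi>_def
      by (auto intro!: continuous_intros continuous_on_product_then_coordinatewise[OF continuous_on_id])
    have f_bound: "norm (f k x) \<le> 1" for k x
      unfolding f_def using \<phi>_bound by (auto simp: abs_prod intro!: prod_le_1)
    have lim: "(\<lambda>k. f k x) \<longlonglongrightarrow> indicator X x" if x: "x \<in> (\<Pi>\<^sub>E i\<in>I. UNIV)" for x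
    proof (cases "x \<in> X")
      case True
      then have "f k x = 1" for k
        unfolding f_def by (intro prod.neutral) (auto simp: X PiE_iff \<phi>_def mult_nonneg_nonpos)
      then show ?thesis using True by simp
    next
      case False
      then obtain i where i: "i \<in> I" "x i - a i > 0"
        using x by (auto simp: X PiE_iff not_le)
      obtain K :: nat where K: "1 / (x i - a i) < real K"
        using reals_Archimedean2 by blast
      have "f k x = 0" if "k \<ge> K" for k
      proof -
        have "1 \<le> real K * (x i - a i)"
          using K i by (simp add: field_simps)
        also have "\<dots> \<le> real k * (x i - a i)"
          using that i by (intro mult_right_mono) auto
        finally have "\<phi> k (x i - a i) = 0" by (simp add: \<phi>_def)
        then show ?thesis
          unfolding f_def using i I by (intro prod_zero) auto
      qed
      then have "\<forall>\<^sub>F k in sequentially. f k x = indicator X x"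
        using False by (auto simp: eventually_sequentially)
      then show ?thesis by (rule tendsto_eventually)
    qed
    have conv: "(\<lambda>k. \<integral>x. f k x \<partial>L) \<longlonglongrightarrow> measure L X"
      if L: "finite_measure L" "sets L = sets (PiM I (\<lambda>_. borel))" for L
    proof -
      interpret L: finite_measure L by fact
      note [measurable_cong] = L(2)
      have sp: "space L = (\<Pi>\<^sub>E i\<in>I. UNIV)"
        using sets_eq_imp_space_eq[OF L(2)] by (simp add: space_PiM)
      have [measurable]: "X \<in> sets L" using X_sets L by simp
      have "(\<lambda>k. \<integral>x. f k x \<partial>L) \<longlonglongrightarrow> (\<integral>x. indicator X x \<partial>L)"
        using lim f_bound by (intro integral_dominated_convergence[where w="\<lambda>_. 1"]) (auto simp: sp)
      then show ?thesis
        using \<open>X \<in> sets L\<close> sets.sets_into_space[of X L] by (simp add: Int_absorb1)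
    qed
    have "(\<lambda>k. \<integral>x. f k x \<partial>\<mu>) \<longlonglongrightarrow> measure \<nu> X"
      using conv[OF \<nu>.finite_measure_axioms sets_\<nu>] Cont[OF f_cont f_meas] by simp
    with conv[OF \<mu>.finite_measure_axioms sets_\<mu>] have "measure \<mu> X = measure \<nu> X"
      by (rule LIMSEQ_unique)
    then show "emeasure \<mu> X = emeasure \<nu> X"
      by (simp add: \<mu>.emeasure_eq_measure \<nu>.emeasure_eq_measure)
  qed
qed

subsection \<open>Radial densities on balls\<close>

interpretation lborel_PiM: product_sigma_finite "\<lambda>_. lborel :: real measure"
  by standard

text \<open>Induction on the dimension: fixing one coordinate y leaves a ball of squared radius A -
  y^2, and \<open>hyp01_slice\<close> performs the remaining integral over y. Using the squared
  radius A, with value 0 for A \<le> 0, lets the induction hypothesis apply for every y, including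
  those whose slice is empty.\<close>

lemma nn_integral_ball_exp:
  fixes p :: real and I :: "'i set"
  assumes "finite I" and p: "p > 0"
  shows "(\<integral>\<^sup>+x. (if (\<Sum>i\<in>I. (x i)\<^sup>2) < A then ennreal ((A - (\<Sum>i\<in>I. (x i)\<^sup>2)) powr (p - 1)) else 0)
            * ennreal (exp (\<Sum>i\<in>I. \<xi> i * x i)) \<partial>PiM I (\<lambda>_. lborel))
     = (if 0 < A then ennreal (pi powr (real (card I) / 2) * Gamma p / Gamma (p + real (card I) / 2) * A powr (p + real (card I) / 2 - 1))
            * hyp01 (p + real (card I) / 2) (A * (\<Sum>i\<in>I. (\<xi> i)\<^sup>2) / 4) else 0)"
  using assms(1)
proof (induction I arbitrary: A rule: finite_induct)
  case empty
  have "Gamma p \<noteq> 0" using Gamma_real_pos[OF p] by simp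
  then show ?case by (simp add: nn_integral_count_space_finite PiM_empty)
next
  case (insert i I)
  let ?S = "\<lambda>x. \<Sum>i\<in>I. (x i)\<^sup>2" and ?X = "\<Sum>i\<in>I. (\<xi> i)\<^sup>2"
  let ?F = "\<lambda>A x. if ?S x < A then ennreal ((A - ?S x) powr (p - 1)) else 0"
  define q where "q = p + real (card I) / 2"
  have q: "q > 0" using p by (simp add: q_def add_pos_nonneg)
  define C where "C = pi powr (real (card I) / 2) * Gamma p / Gamma q"
  have G: "Gamma p > 0" "Gamma q > 0" "Gamma (q + 1/2) > 0"
    using p q by (auto intro!: Gamma_real_pos)
  have C: "C \<ge> 0" using G by (simp add: C_def)
  have card: "card (insert i I) = Suc (card I)" using insert by simp
  have upd: "(\<Sum>j\<in>I. ((x(i := y)) j)\<^sup>2) = (\<Sum>j\<in>I. (x j)\<^sup>2)"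
    "(\<Sum>j\<in>I. \<xi> j * (x(i := y)) j) = (\<Sum>j\<in>I. \<xi> j * x j)" for x :: "'i \<Rightarrow> real" and y
    using insert by (auto intro!: sum.cong)
  have "(\<integral>\<^sup>+x. (if (\<Sum>i\<in>insert i I. (x i)\<^sup>2) < A then ennreal ((A - (\<Sum>i\<in>insert i I. (x i)\<^sup>2)) powr (p - 1)) else 0)
            * ennreal (exp (\<Sum>i\<in>insert i I. \<xi> i * x i)) \<partial>PiM (insert i I) (\<lambda>_. lborel))
    = (\<integral>\<^sup>+y. \<integral>\<^sup>+x. ennreal (exp (\<xi> i * y)) * (?F (A - y\<^sup>2) x * ennreal (exp (\<Sum>i\<in>I. \<xi> i * x i))) \<partial>PiM I (\<lambda>_. lborel) \<partial>lborel)"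
  proof (subst lborel_PiM.product_nn_integral_insert_rev[OF insert(1,2)], measurable, intro nn_integral_cong)
    fix y :: real and x :: "'i \<Rightarrow> real"
    have c: "y\<^sup>2 + ?S x < A \<longleftrightarrow> ?S x < A - y\<^sup>2" "A - (y\<^sup>2 + ?S x) = A - y\<^sup>2 - ?S x" by auto
    show "(if (\<Sum>j\<in>insert i I. ((x(i := y)) j)\<^sup>2) < A then ennreal ((A - (\<Sum>j\<in>insert i I. ((x(i := y)) j)\<^sup>2)) powr (p - 1)) else 0)
            * ennreal (exp (\<Sum>j\<in>insert i I. \<xi> j * (x(i := y)) j))
       = ennreal (exp (\<xi> i * y)) * (?F (A - y\<^sup>2) x * ennreal (exp (\<Sum>i\<in>I. \<xi> i * x i)))"
      using insert(1,2) by (simp add: upd c exp_add ennreal_mult mult_ac del: fun_upd_apply) (simp add: diff_diff_eq mult_ac)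
  qed
  also have "\<dots> = (\<integral>\<^sup>+y. ennreal (exp (\<xi> i * y)) * (if 0 < A - y\<^sup>2 then ennreal (C * (A - y\<^sup>2) powr (q - 1)) * hyp01 q ((A - y\<^sup>2) * ?X / 4) else 0) \<partial>lborel)"
  proof (rule nn_integral_cong)
    fix y :: real
    have "(\<integral>\<^sup>+x. ennreal (exp (\<xi> i * y)) * (?F (A - y\<^sup>2) x * ennreal (exp (\<Sum>i\<in>I. \<xi> i * x i))) \<partial>PiM I (\<lambda>_. lborel))
      = ennreal (exp (\<xi> i * y)) * (\<integral>\<^sup>+x. ?F (A - y\<^sup>2) x * ennreal (exp (\<Sum>i\<in>I. \<xi> i * x i)) \<partial>PiM I (\<lambda>_. lborel))"
      by (rule nn_integral_cmult) measurable
    then show "(\<integral>\<^sup>+x. ennreal (exp (\<xi> i * y)) * (?F (A - y\<^sup>2) x * ennreal (exp (\<Sum>i\<in>I. \<xi> i * x i))) \<partial>PiM I (\<lambda>_. lborel))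
      = ennreal (exp (\<xi> i * y)) * (if 0 < A - y\<^sup>2 then ennreal (C * (A - y\<^sup>2) powr (q - 1)) * hyp01 q ((A - y\<^sup>2) * ?X / 4) else 0)"
      unfolding insert.IH q_def[symmetric] C_def by simp
  qed
  also have "\<dots> = (if 0 < A then ennreal (C * (sqrt pi * Gamma q / Gamma (q + 1/2) * A powr (q + 1/2 - 1))) * hyp01 (q + 1/2) (A * (\<Sum>i\<in>insert i I. (\<xi> i)\<^sup>2) / 4) else 0)"
  proof (cases "A > 0")
    case False
    then have "\<not> 0 < A - y\<^sup>2" for y using zero_le_power2[of y] by linarith
    with False show ?thesis by simp
  next
    case True
    define R where "R = sqrt A"
    have R: "R > 0" "R\<^sup>2 = A" using True by (auto simp: R_def)
    have R': "-R < y \<and> y < R \<longleftrightarrow> 0 < A - y\<^sup>2" for y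
      using abs_square_less_1 real_less_rsqrt R abs_less_iff[of y R] power2_less_imp_less[of y R]
      by (metis abs_le_square_iff abs_of_pos diff_gt_0_iff_gt linorder_not_le minus_less_iff)
    have RA: "R powr (2 * q - 1) = A powr (q + 1/2 - 1)"
      using R(1) powr_powr[of R 2 "q + 1/2 - 1"] by (simp add: algebra_simps flip: R(2))
    have "(\<integral>\<^sup>+y. ennreal (exp (\<xi> i * y)) * (if 0 < A - y\<^sup>2 then ennreal (C * (A - y\<^sup>2) powr (q - 1)) * hyp01 q ((A - y\<^sup>2) * ?X / 4) else 0) \<partial>lborel)
      = (\<integral>\<^sup>+y. ennreal C * (ennreal ((R\<^sup>2 - y\<^sup>2) powr (q - 1) * exp (\<xi> i * y)) * hyp01 q (?X / 4 * (R\<^sup>2 - y\<^sup>2)) * indicator {-R<..<R} y) \<partial>lborel)"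
      by (intro nn_integral_cong) (auto simp: indicator_def R' R(2) ennreal_mult C mult_ac)
    also have "\<dots> = ennreal C * (\<integral>\<^sup>+y. ennreal ((R\<^sup>2 - y\<^sup>2) powr (q - 1) * exp (\<xi> i * y)) * hyp01 q (?X / 4 * (R\<^sup>2 - y\<^sup>2)) * indicator {-R<..<R} y \<partial>lborel)"
      by (rule nn_integral_cmult) measurable
    also have "\<dots> = ennreal C * (ennreal (sqrt pi * Gamma q / Gamma (q + 1/2) * R powr (2 * q - 1)) * hyp01 (q + 1/2) (R\<^sup>2 * (?X / 4 + (\<xi> i)\<^sup>2 / 4)))"
      by (subst hyp01_slice[OF q R(1)]) (simp_all add: sum_nonneg)
    also have "\<dots> = ennreal (C * (sqrt pi * Gamma q / Gamma (q + 1/2) * A powr (q + 1/2 - 1))) * hyp01 (q + 1/2) (A * (\<Sum>i\<in>insert i I. (\<xi> i)\<^sup>2) / 4)"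
    proof -
      have "R\<^sup>2 * (?X / 4 + (\<xi> i)\<^sup>2 / 4) = A * (\<Sum>i\<in>insert i I. (\<xi> i)\<^sup>2) / 4"
        using insert(1,2) R by (simp add: algebra_simps)
      moreover have "sqrt pi * Gamma q / Gamma (q + 1/2) * A powr (q + 1/2 - 1) \<ge> 0"
        using G by simp
      ultimately show ?thesis
        by (simp only: RA ennreal_mult[OF C] mult.assoc)
    qed
    finally show ?thesis using True by simp
  qed
  also have "C * (sqrt pi * Gamma q / Gamma (q + 1/2) * A powr (q + 1/2 - 1))
     = pi powr (real (card (insert i I)) / 2) * Gamma p / Gamma (p + real (card (insert i I)) / 2) * A powr (p + real (card (insert i I)) / 2 - 1)"
  proof -
    have "p + real (card (insert i I)) / 2 = q + 1/2" by (simp add: card q_def add_divide_distrib)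
    moreover have "pi powr (real (card (insert i I)) / 2) = pi powr (real (card I) / 2) * sqrt pi"
      by (simp add: card add_divide_distrib powr_add powr_half_sqrt)
    ultimately show ?thesis using G by (simp add: C_def)
  qed
  also have "q + 1/2 = p + real (card (insert i I)) / 2" by (simp add: card q_def add_divide_distrib)
  finally show ?case .
qed

text \<open>The density is indexed by the parameter Q of its moment generating function instead of
  by its exponent. Lowering m then changes the exponent but not Q, which is how a projection stays
  in the family. The constants are those that give total mass 1.\<close>

definition radial_density :: "real \<Rightarrow> nat \<Rightarrow> real \<Rightarrow> (nat \<Rightarrow> real) \<Rightarrow> real" where
  "radial_density Q m R x =
     (if L2_set x {1..m} < R
      then Gamma Q / Gamma (Q - real m / 2)
           * ((R\<^sup>2 - (L2_set x {1..m})\<^sup>2) powr (Q - real m / 2 - 1) / (pi powr (real m / 2) * R powr (2 * Q - 2)))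
      else 0)"

lemma measurable_radial_density [measurable]:
  "radial_density Q m R \<in> borel_measurable (PiM {1..m} (\<lambda>_. lborel))"
  unfolding radial_density_def L2_set_def by measurable

lemma mgf_radial_density:
  assumes R: "R > 0" and Q: "Q - real m / 2 > 0"
  shows "(\<integral>\<^sup>+x. ennreal (exp (\<Sum>i\<in>{1..m}. \<xi> i * x i)) \<partial>density (PiM {1..m} (\<lambda>_. lborel)) (\<lambda>x. ennreal (radial_density Q m R x)))
     = hyp01 Q (R\<^sup>2 * (\<Sum>i\<in>{1..m}. (\<xi> i)\<^sup>2) / 4)"
proof -
  let ?I = "{1..m}" and ?L = "PiM {1..m} (\<lambda>_. lborel :: real measure)"
  define p where "p = Q - real m / 2"
  have p: "p > 0" "p + real m / 2 = Q" "Q > 0" using Q by (auto simp: p_def)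
  have G: "Gamma p > 0" "Gamma Q > 0" using p by (auto intro!: Gamma_real_pos)
  define K where "K = Gamma Q / Gamma p / (pi powr (real m / 2) * R powr (2 * Q - 2))"
  have K: "K \<ge> 0" using G by (simp add: K_def)
  let ?B = "\<lambda>x. if (\<Sum>i\<in>?I. (x i)\<^sup>2) < R\<^sup>2 then ennreal ((R\<^sup>2 - (\<Sum>i\<in>?I. (x i)\<^sup>2)) powr (p - 1)) else 0"
  have eq: "ennreal (radial_density Q m R x) = ennreal K * ?B x" for x
  proof -
    have "(L2_set x ?I)\<^sup>2 = (\<Sum>i\<in>?I. (x i)\<^sup>2)"
      unfolding L2_set_def by (intro real_sqrt_pow2 sum_nonneg) auto
    moreover from this have "L2_set x ?I < R \<longleftrightarrow> (\<Sum>i\<in>?I. (x i)\<^sup>2) < R\<^sup>2"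
      using real_sqrt_less_iff[of "\<Sum>i\<in>?I. (x i)\<^sup>2" "R\<^sup>2"] R by (simp add: L2_set_def)
    ultimately show ?thesis
      using K by (simp add: radial_density_def p_def[symmetric] K_def flip: ennreal_mult)
  qed
  have "(\<integral>\<^sup>+x. ennreal (exp (\<Sum>i\<in>?I. \<xi> i * x i)) \<partial>density ?L (\<lambda>x. ennreal (radial_density Q m R x)))
    = (\<integral>\<^sup>+x. ennreal (radial_density Q m R x) * ennreal (exp (\<Sum>i\<in>?I. \<xi> i * x i)) \<partial>?L)"
    by (rule nn_integral_density) measurable
  also have "\<dots> = (\<integral>\<^sup>+x. ennreal K * (?B x * ennreal (exp (\<Sum>i\<in>?I. \<xi> i * x i))) \<partial>?L)"
    by (simp only: eq mult.assoc)
  also have "\<dots> = ennreal K * (\<integral>\<^sup>+x. ?B x * ennreal (exp (\<Sum>i\<in>?I. \<xi> i * x i)) \<partial>?L)"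
    by (rule nn_integral_cmult) measurable
  also have "\<dots> = ennreal K * (ennreal (pi powr (real m / 2) * Gamma p / Gamma Q * (R\<^sup>2) powr (Q - 1))
            * hyp01 Q (R\<^sup>2 * (\<Sum>i\<in>?I. (\<xi> i)\<^sup>2) / 4))"
    using R by (subst nn_integral_ball_exp[OF _ p(1)]) (simp_all add: p(2))
  also have "\<dots> = ennreal (K * (pi powr (real m / 2) * Gamma p / Gamma Q * (R\<^sup>2) powr (Q - 1))) * hyp01 Q (R\<^sup>2 * (\<Sum>i\<in>?I. (\<xi> i)\<^sup>2) / 4)"
  proof -
    have "pi powr (real m / 2) * Gamma p / Gamma Q * (R\<^sup>2) powr (Q - 1) \<ge> 0" using G by simp
    then show ?thesis by (simp only: ennreal_mult[OF K] mult.assoc)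
  qed
  also have "K * (pi powr (real m / 2) * Gamma p / Gamma Q * (R\<^sup>2) powr (Q - 1)) = 1"
  proof -
    have "(R\<^sup>2) powr (Q - 1) = R powr (2 * Q - 2)"
      using R powr_powr[of R 2 "Q - 1"] by (simp add: algebra_simps)
    then show ?thesis using G R by (simp add: K_def)
  qed
  finally show ?thesis by simp
qed

lemma distr_eq_radial_density:
  assumes X: "X \<in> M \<rightarrow>\<^sub>M PiM {1..m} (\<lambda>_. lborel)" and R: "R > 0" and Q: "Q - real m / 2 > 0"
    and mgf: "\<And>\<xi>. (\<integral>\<^sup>+\<omega>. ennreal (exp (\<Sum>i\<in>{1..m}. \<xi> i * X \<omega> i)) \<partial>M) = hyp01 Q (R\<^sup>2 * (\<Sum>i\<in>{1..m}. (\<xi> i)\<^sup>2) / 4)"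
  shows "distributed M (PiM {1..m} (\<lambda>_. lborel)) X (\<lambda>x. ennreal (radial_density Q m R x))"
proof -
  let ?L = "PiM {1..m} (\<lambda>_. lborel :: real measure)"
  let ?\<nu> = "density ?L (\<lambda>x. ennreal (radial_density Q m R x))"
  have "distr M ?L X = ?\<nu>"
  proof (rule measure_eqI_mgf)
    \<comment> \<open>The total mass is the transform at frequency 0, which is
      \<open>hyp01 Q 0 = 1\<close>.\<close>
    show "finite_measure ?\<nu>"
      using mgf_radial_density[OF R Q, of "\<lambda>_. 0"] by (intro finite_measureI) simp
    show "AE x in ?\<nu>. \<forall>i\<in>{1..m}. \<bar>x i\<bar> \<le> R"
    proof (subst AE_density, measurable, intro AE_I2 impI ballI)
      fix x i assume "0 < ennreal (radial_density Q m R x)" and i: "i \<in> {1..m}"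
      then have "L2_set x {1..m} < R" by (auto simp: radial_density_def split: if_splits)
      moreover have "\<bar>x i\<bar> \<le> L2_set (\<lambda>i. \<bar>x i\<bar>) {1..m}"
        using i by (intro member_le_L2_set) auto
      moreover have "L2_set (\<lambda>i. \<bar>x i\<bar>) {1..m} = L2_set x {1..m}" by (simp add: L2_set_def)
      ultimately show "\<bar>x i\<bar> \<le> R" by linarith
    qed
    fix \<xi> :: "nat \<Rightarrow> real"
    show "(\<integral>\<^sup>+x. ennreal (exp (\<Sum>i\<in>{1..m}. \<xi> i * x i)) \<partial>distr M ?L X) = (\<integral>\<^sup>+x. ennreal (exp (\<Sum>i\<in>{1..m}. \<xi> i * x i)) \<partial>?\<nu>)"
      unfolding mgf_radial_density[OF R Q] mgf[symmetric] by (rule nn_integral_distr[OF X]) measurable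
  qed (auto intro!: sets_PiM_cong)
  moreover have "(\<lambda>x. ennreal (radial_density Q m R x)) \<in> borel_measurable ?L" by measurable
  ultimately show ?thesis
    unfolding distributed_def using X by blast
qed

subsection \<open>The uniform distribution on the sphere\<close>

text \<open>The substitution u = - cos \<theta>, increasing on [0, pi], turns this into
  \<open>hyp01_slice\<close> with R = 1. The sign replaces x by -x, which is harmless as the result
  contains x only squared.\<close>

lemma hyp01_slice_angle:
  fixes b x y :: real
  assumes b: "b > 0" and y: "y \<ge> 0"
  shows "(\<integral>\<^sup>+\<theta>. ennreal (sin \<theta> powr (2 * b - 1) * exp (x * cos \<theta>)) * hyp01 b (y * (sin \<theta>)\<^sup>2)
            * indicator {0..pi} \<theta> \<partial>lborel)
     = ennreal (sqrt pi * Gamma b / Gamma (b + 1/2)) * hyp01 (b + 1/2) (y + x\<^sup>2 / 4)"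
proof -
  let ?f = "\<lambda>u. ennreal ((1\<^sup>2 - u\<^sup>2) powr (b - 1) * exp (- x * u)) * hyp01 b (y * (1\<^sup>2 - u\<^sup>2))"
  have "(\<integral>\<^sup>+\<theta>. ennreal (sin \<theta> powr (2 * b - 1) * exp (x * cos \<theta>)) * hyp01 b (y * (sin \<theta>)\<^sup>2)
            * indicator {0..pi} \<theta> \<partial>lborel)
    = (\<integral>\<^sup>+\<theta>. ?f (- cos \<theta>) * ennreal (sin \<theta>) * indicator {0..pi} \<theta> \<partial>lborel)"
  proof (rule nn_integral_cong)
    fix \<theta> :: real
    have "sin \<theta> powr (2 * b - 1) = ((sin \<theta>)\<^sup>2) powr (b - 1) * sin \<theta>" if s: "sin \<theta> \<ge> 0"
    proof (cases "sin \<theta> = 0")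
      case False
      with s have p: "sin \<theta> > 0" by simp
      then show ?thesis
        using powr_powr[of "sin \<theta>" 2 "b - 1"] powr_add[of "sin \<theta>" "2 * (b - 1)" 1] by simp
    qed simp
    moreover have "1\<^sup>2 - (- cos \<theta>)\<^sup>2 = (sin \<theta>)\<^sup>2" by (simp add: sin_squared_eq)
    ultimately show "ennreal (sin \<theta> powr (2 * b - 1) * exp (x * cos \<theta>)) * hyp01 b (y * (sin \<theta>)\<^sup>2) * indicator {0..pi} \<theta>
      = ?f (- cos \<theta>) * ennreal (sin \<theta>) * indicator {0..pi} \<theta>"
      using sin_ge_zero[of \<theta>] by (auto simp: indicator_def ennreal_mult mult_ac)
  qed
  also have "\<dots> = (\<integral>\<^sup>+u. ?f u * indicator {- cos 0..- cos pi} u \<partial>lborel)"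
    by (rule nn_integral_substitution_aux[symmetric])
       (auto intro!: derivative_eq_intros continuous_intros sin_ge_zero)
  \<comment> \<open>At u = 1 and u = -1 the weight is \<open>0 powr (b - 1) = 0\<close>, so both end
    points may be dropped.\<close>
  also have "\<dots> = (\<integral>\<^sup>+u. ?f u * indicator {-1<..<1} u \<partial>lborel)"
    by (intro nn_integral_cong) (auto simp: indicator_def not_less le_less)
  also have "\<dots> = ennreal (sqrt pi * Gamma b / Gamma (b + 1/2)) * hyp01 (b + 1/2) (y + x\<^sup>2 / 4)"
    using hyp01_slice[OF b zero_less_one y, of "- x"] by simp
  finally show ?thesis .
qed

text \<open>This is the last angle, which runs over a whole circle. Reflecting the lower half onto
  the upper one changes the sign of the sine; the two exponentials add up to a cosh, a 0F1 with
  parameter 1/2, and \<open>hyp01_slice_angle\<close> raises the parameter to 1 = 2/2.\<close>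

lemma hyp01_full_angle:
  fixes a b :: real
  shows "(\<integral>\<^sup>+\<theta>. ennreal (exp (a * cos \<theta> + b * sin \<theta>)) * indicator {0..2 * pi} \<theta> \<partial>lborel)
     = ennreal (2 * pi) * hyp01 1 ((a\<^sup>2 + b\<^sup>2) / 4)"
proof -
  let ?e = "\<lambda>a b \<theta>. ennreal (exp (a * cos \<theta> + b * sin \<theta>))"
  have "AE \<theta> in lborel. \<theta> \<noteq> 0 \<and> \<theta> \<noteq> pi \<and> \<theta> \<noteq> 2 * pi"
    using AE_lborel_singleton[of "0::real"] AE_lborel_singleton[of pi] AE_lborel_singleton[of "2 * pi"]
    by eventually_elim auto
  then have "(\<integral>\<^sup>+\<theta>. ?e a b \<theta> * indicator {0..2 * pi} \<theta> \<partial>lborel)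
    = (\<integral>\<^sup>+\<theta>. ?e a b \<theta> * indicator {0<..<pi} \<theta> + ?e a b \<theta> * indicator {pi<..<2 * pi} \<theta> \<partial>lborel)"
    by (intro nn_integral_cong_AE, elim eventually_mono) (auto simp: indicator_def)
  also have "\<dots> = (\<integral>\<^sup>+\<theta>. ?e a b \<theta> * indicator {0<..<pi} \<theta> \<partial>lborel) + (\<integral>\<^sup>+\<theta>. ?e a b \<theta> * indicator {pi<..<2 * pi} \<theta> \<partial>lborel)"
    by (rule nn_integral_add) measurable
  also have "(\<integral>\<^sup>+\<theta>. ?e a b \<theta> * indicator {pi<..<2 * pi} \<theta> \<partial>lborel) = (\<integral>\<^sup>+\<theta>. ?e a (- b) \<theta> * indicator {0<..<pi} \<theta> \<partial>lborel)"
    by (subst nn_integral_real_affine[where c="-1" and t="2 * pi"])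
       (auto intro!: nn_integral_cong simp: indicator_def cos_diff sin_diff)
  also have "(\<integral>\<^sup>+\<theta>. ?e a b \<theta> * indicator {0<..<pi} \<theta> \<partial>lborel) + (\<integral>\<^sup>+\<theta>. ?e a (- b) \<theta> * indicator {0<..<pi} \<theta> \<partial>lborel)
    = (\<integral>\<^sup>+\<theta>. ?e a b \<theta> * indicator {0<..<pi} \<theta> + ?e a (- b) \<theta> * indicator {0<..<pi} \<theta> \<partial>lborel)"
    by (rule nn_integral_add[symmetric]) measurable
  \<comment> \<open>The inserted power of the sine has exponent 0: it is 1 inside the interval and 0
    at the end points. It gives the integrand the form of \<open>hyp01_slice_angle\<close> at b =
    1/2 and allows the closed interval.\<close>
  also have "\<dots> = (\<integral>\<^sup>+\<theta>. 2 * (ennreal (sin \<theta> powr (2 * (1/2) - 1) * exp (a * cos \<theta>)) * hyp01 (1/2) (b\<^sup>2 / 4 * (sin \<theta>)\<^sup>2) * indicator {0..pi} \<theta>) \<partial>lborel)"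
  proof (rule nn_integral_cong)
    fix \<theta> :: real
    have e: "?e a b \<theta> + ?e a (- b) \<theta> = 2 * (ennreal (exp (a * cos \<theta>)) * ennreal (cosh (b * sin \<theta>)))"
    proof -
      have "exp (a * cos \<theta> + b * sin \<theta>) + exp (a * cos \<theta> + - b * sin \<theta>) = 2 * (exp (a * cos \<theta>) * cosh (b * sin \<theta>))"
        by (simp add: cosh_def exp_add exp_diff exp_minus field_simps)
      then show ?thesis
        by (simp flip: ennreal_plus ennreal_numeral ennreal_mult)
    qed
    have h: "hyp01 (1/2) (b\<^sup>2 / 4 * (sin \<theta>)\<^sup>2) = ennreal (cosh (b * sin \<theta>))"
      using hyp01_half[of "b * sin \<theta>"] by (simp add: power_mult_distrib)
    show "?e a b \<theta> * indicator {0<..<pi} \<theta> + ?e a (- b) \<theta> * indicator {0<..<pi} \<theta>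
      = 2 * (ennreal (sin \<theta> powr (2 * (1/2) - 1) * exp (a * cos \<theta>)) * hyp01 (1/2) (b\<^sup>2 / 4 * (sin \<theta>)\<^sup>2) * indicator {0..pi} \<theta>)"
    proof (cases "\<theta> \<in> {0<..<pi}")
      case True
      then have "sin \<theta> > 0" by (intro sin_gt_zero) auto
      then show ?thesis using True e unfolding h by simp
    next
      case False
      then have "sin \<theta> = 0 \<or> indicator {0..pi} \<theta> = (0::ennreal)"
        by (cases "\<theta> = 0 \<or> \<theta> = pi") (auto simp: indicator_def)
      then show ?thesis using False by auto
    qed
  qed
  also have "\<dots> = 2 * (\<integral>\<^sup>+\<theta>. ennreal (sin \<theta> powr (2 * (1/2) - 1) * exp (a * cos \<theta>)) * hyp01 (1/2) (b\<^sup>2 / 4 * (sin \<theta>)\<^sup>2) * indicator {0..pi} \<theta> \<partial>lborel)"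
    by (rule nn_integral_cmult) measurable
  also have "\<dots> = 2 * (ennreal (sqrt pi * Gamma (1/2) / Gamma (1/2 + 1/2)) * hyp01 (1/2 + 1/2) (b\<^sup>2 / 4 + a\<^sup>2 / 4))"
    by (subst hyp01_slice_angle) auto
  also have "\<dots> = ennreal (2 * pi) * hyp01 1 ((a\<^sup>2 + b\<^sup>2) / 4)"
    by (simp add: Gamma_one_half_real add_divide_distrib add.commute ennreal_mult mult.assoc)
  finally show ?thesis .
qed

text \<open>The inner product of (\<xi>_k, ..., \<xi>_d) with the point of the unit sphere of
  dimension d - k whose angles are \<psi>_k, ..., \<psi>_{d-1}. For k = 1 it is the inner product of
  \<xi> with the direction itself; the first angle can be peeled off, leaving the tail at k + 1
  scaled by its sine.\<close>

definition direction_tail :: "(nat \<Rightarrow> real) \<Rightarrow> nat \<Rightarrow> nat \<Rightarrow> (nat \<Rightarrow> real) \<Rightarrow> real" where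
  "direction_tail \<xi> d k \<psi> =
     (\<Sum>j\<in>{k..d}. \<xi> j * ((\<Prod>i\<in>{k..<j}. sin (\<psi> i)) * (if j < d then cos (\<psi> j) else 1)))"

text \<open>The unnormalised angle density, split into one factor per angle so that the angles can
  be integrated one at a time. The index d - 1 is singled out for its range [0, 2 pi]; its power of
  the sine is 0.\<close>

definition angle_weight :: "nat \<Rightarrow> nat \<Rightarrow> real \<Rightarrow> real" where
  "angle_weight d i \<theta> =
     (if i = d - 1 then indicator {0..2 * pi} \<theta> else sin \<theta> ^ (d - 1 - i) * indicator {0..pi} \<theta>)"

lemma measurable_angle_weight [measurable]: "angle_weight d i \<in> borel_measurable borel"
  unfolding angle_weight_def by measurable

lemma angle_weight_nonneg: "angle_weight d i \<theta> \<ge> 0"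
  by (auto simp: angle_weight_def indicator_def sin_ge_zero)

lemma direction_tail_last: "direction_tail \<xi> d d \<psi> = \<xi> d"
  by (simp add: direction_tail_def)

lemma direction_tail_rec:
  assumes "k < d"
  shows "direction_tail \<xi> d k \<psi> = \<xi> k * cos (\<psi> k) + sin (\<psi> k) * direction_tail \<xi> d (Suc k) \<psi>"
proof -
  have "direction_tail \<xi> d k \<psi> = \<xi> k * cos (\<psi> k)
      + (\<Sum>j\<in>{Suc k..d}. \<xi> j * ((\<Prod>i\<in>{k..<j}. sin (\<psi> i)) * (if j < d then cos (\<psi> j) else 1)))"
    using assms by (simp add: direction_tail_def sum.atLeast_Suc_atMost)
  also have "(\<Sum>j\<in>{Suc k..d}. \<xi> j * ((\<Prod>i\<in>{k..<j}. sin (\<psi> i)) * (if j < d then cos (\<psi> j) else 1)))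
      = (\<Sum>j\<in>{Suc k..d}. sin (\<psi> k) * (\<xi> j * ((\<Prod>i\<in>{Suc k..<j}. sin (\<psi> i)) * (if j < d then cos (\<psi> j) else 1))))"
    by (intro sum.cong refl) (simp add: prod.atLeast_Suc_lessThan)
  finally show ?thesis
    by (simp add: direction_tail_def sum_distrib_left)
qed

lemma direction_tail_upd:
  "direction_tail \<xi> d (Suc k) (\<psi>(k := y)) = direction_tail \<xi> d (Suc k) \<psi>"
  unfolding direction_tail_def
  by (intro sum.cong refl arg_cong2[where f="(*)"] prod.cong) auto

lemma measurable_direction_tail [measurable]:
  "direction_tail \<xi> d k \<in> borel_measurable (PiM {k..d-1} (\<lambda>_. lborel))"
  unfolding direction_tail_def
proof (intro borel_measurable_sum borel_measurable_times borel_measurable_const)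
  fix j assume j: "j \<in> {k..d}"
  have comp: "(\<lambda>\<psi>::nat\<Rightarrow>real. \<psi> i) \<in> borel_measurable (PiM {k..d-1} (\<lambda>_. lborel))" if "i \<in> {k..d-1}" for i
    using measurable_component_singleton[OF that, of "\<lambda>_. lborel :: real measure"] by simp
  show "(\<lambda>\<psi>::nat\<Rightarrow>real. \<Prod>i\<in>{k..<j}. sin (\<psi> i)) \<in> borel_measurable (PiM {k..d-1} (\<lambda>_. lborel))"
    using j by (intro borel_measurable_prod borel_measurable_sin comp) auto
  show "(\<lambda>\<psi>::nat\<Rightarrow>real. if j < d then cos (\<psi> j) else 1) \<in> borel_measurable (PiM {k..d-1} (\<lambda>_. lborel))"
    using j by (cases "j < d") (auto intro!: borel_measurable_cos comp)
qed

text \<open>Downward induction from the last angle, each step raising the parameter by 1/2. The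
  constant K is chosen before s on purpose: the induction hypothesis is used with s sin \<theta>
  under the integral over \<theta>, and the normalisation is later read off by comparing s = 0 with
  s = 1.\<close>

lemma nn_integral_direction_tail:
  assumes "1 \<le> k" "k \<le> d - 1"
  shows "\<exists>K. \<forall>s. (\<integral>\<^sup>+\<psi>. (\<Prod>i\<in>{k..d-1}. ennreal (angle_weight d i (\<psi> i))) * ennreal (exp (s * direction_tail \<xi> d k \<psi>)) \<partial>PiM {k..d-1} (\<lambda>_. lborel))
     = K * hyp01 (real (d - k + 1) / 2) (s\<^sup>2 * (\<Sum>j\<in>{k..d}. (\<xi> j)\<^sup>2) / 4)"
  using assms(2)
proof (induction k rule: inc_induct)
  case base
  define k where "k = d - 1"
  have d: "d = Suc k" using assms by (simp add: k_def)
  show ?case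
  proof (intro exI[of _ "ennreal (2 * pi)"] allI)
    fix s :: real
    let ?g = "\<lambda>\<theta>. ennreal (exp (s * \<xi> k * cos \<theta> + s * \<xi> d * sin \<theta>)) * indicator {0..2 * pi} \<theta>"
    have "(\<integral>\<^sup>+\<psi>. (\<Prod>i\<in>{d-1..d-1}. ennreal (angle_weight d i (\<psi> i))) * ennreal (exp (s * direction_tail \<xi> d (d-1) \<psi>)) \<partial>PiM {d-1..d-1} (\<lambda>_. lborel))
      = (\<integral>\<^sup>+\<psi>. ?g (\<psi> k) \<partial>PiM {k} (\<lambda>_. lborel))"
    proof -
      have "(\<Prod>i\<in>{d-1..d-1}. ennreal (angle_weight d i (\<psi> i))) * ennreal (exp (s * direction_tail \<xi> d (d-1) \<psi>)) = ?g (\<psi> k)" for \<psi>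
        using direction_tail_rec[of k d \<xi> \<psi>]
        by (simp add: d direction_tail_last[of \<xi> "Suc k"] angle_weight_def indicator_def algebra_simps)
      then show ?thesis by (simp add: d)
    qed
    also have "\<dots> = (\<integral>\<^sup>+\<theta>. ?g \<theta> \<partial>lborel)"
      by (rule lborel_PiM.product_nn_integral_singleton) measurable
    also have "\<dots> = ennreal (2 * pi) * hyp01 1 (((s * \<xi> k)\<^sup>2 + (s * \<xi> d)\<^sup>2) / 4)"
      by (rule hyp01_full_angle)
    also have "((s * \<xi> k)\<^sup>2 + (s * \<xi> d)\<^sup>2) / 4 = s\<^sup>2 * (\<Sum>j\<in>{d-1..d}. (\<xi> j)\<^sup>2) / 4"
      by (simp add: d power_mult_distrib algebra_simps)
    finally show "(\<integral>\<^sup>+\<psi>. (\<Prod>i\<in>{d-1..d-1}. ennreal (angle_weight d i (\<psi> i))) * ennreal (exp (s * direction_tail \<xi> d (d-1) \<psi>)) \<partial>PiM {d-1..d-1} (\<lambda>_. lborel))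
     = ennreal (2 * pi) * hyp01 (real (d - (d - 1) + 1) / 2) (s\<^sup>2 * (\<Sum>j\<in>{d-1..d}. (\<xi> j)\<^sup>2) / 4)"
      using assms by simp
  qed
next
  case (step k)
  let ?S = "\<Sum>j\<in>{Suc k..d}. (\<xi> j)\<^sup>2"
  from step.IH obtain K where IH: "\<And>s. (\<integral>\<^sup>+\<psi>. (\<Prod>i\<in>{Suc k..d-1}. ennreal (angle_weight d i (\<psi> i))) * ennreal (exp (s * direction_tail \<xi> d (Suc k) \<psi>)) \<partial>PiM {Suc k..d-1} (\<lambda>_. lborel))
     = K * hyp01 (real (d - Suc k + 1) / 2) (s\<^sup>2 * ?S / 4)"
    by auto
  \<comment> \<open>Here b = (d - k)/2 is half the number of coordinates in the inner tail. The
    weight of the angle k has exponent d - 1 - k = 2b - 1, exactly the one that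
    \<open>hyp01_slice_angle\<close> requires.\<close>
  define b where "b = real (d - Suc k + 1) / 2"
  have b: "b > 0" "2 * b - 1 = real (d - 1 - k)" "b + 1/2 = real (d - k + 1) / 2"
    using step.hyps by (auto simp: b_def of_nat_diff field_simps)
  have I: "{k..d-1} = insert k {Suc k..d-1}" using step.hyps by auto
  show ?case
  proof (intro exI[of _ "K * ennreal (sqrt pi * Gamma b / Gamma (b + 1/2))"] allI)
    fix s :: real
    have meas: "(\<lambda>\<psi>. (\<Prod>i\<in>{k..d-1}. ennreal (angle_weight d i (\<psi> i))) * ennreal (exp (s * direction_tail \<xi> d k \<psi>)))
       \<in> borel_measurable (PiM {k..d-1} (\<lambda>_. lborel))" by measurable
    have "(\<integral>\<^sup>+\<psi>. (\<Prod>i\<in>{k..d-1}. ennreal (angle_weight d i (\<psi> i))) * ennreal (exp (s * direction_tail \<xi> d k \<psi>)) \<partial>PiM {k..d-1} (\<lambda>_. lborel))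
      = (\<integral>\<^sup>+\<theta>. \<integral>\<^sup>+\<psi>. (\<Prod>i\<in>{k..d-1}. ennreal (angle_weight d i ((\<psi>(k := \<theta>)) i))) * ennreal (exp (s * direction_tail \<xi> d k (\<psi>(k := \<theta>)))) \<partial>PiM {Suc k..d-1} (\<lambda>_. lborel) \<partial>lborel)"
      using lborel_PiM.product_nn_integral_insert_rev[of "{Suc k..d-1}" k] meas by (simp only: I) simp
    also have "\<dots> = (\<integral>\<^sup>+\<theta>. \<integral>\<^sup>+\<psi>. ennreal (angle_weight d k \<theta> * exp (s * \<xi> k * cos \<theta>)) *
        ((\<Prod>i\<in>{Suc k..d-1}. ennreal (angle_weight d i (\<psi> i))) * ennreal (exp (s * sin \<theta> * direction_tail \<xi> d (Suc k) \<psi>))) \<partial>PiM {Suc k..d-1} (\<lambda>_. lborel) \<partial>lborel)"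
    proof (intro nn_integral_cong)
      fix \<theta> :: real and \<psi> :: "nat \<Rightarrow> real"
      have "(\<Prod>i\<in>{k..d-1}. ennreal (angle_weight d i ((\<psi>(k := \<theta>)) i)))
        = ennreal (angle_weight d k \<theta>) * (\<Prod>i\<in>{Suc k..d-1}. ennreal (angle_weight d i (\<psi> i)))"
        unfolding I by (subst prod.insert) (auto intro!: prod.cong arg_cong2[where f="(*)"])
      moreover have "exp (s * direction_tail \<xi> d k (\<psi>(k := \<theta>)))
        = exp (s * \<xi> k * cos \<theta>) * exp (s * sin \<theta> * direction_tail \<xi> d (Suc k) \<psi>)"
        using step.hyps direction_tail_rec[of k d \<xi> "\<psi>(k := \<theta>)"]
        by (simp add: direction_tail_upd algebra_simps flip: exp_add)
      ultimately show "(\<Prod>i\<in>{k..d-1}. ennreal (angle_weight d i ((\<psi>(k := \<theta>)) i))) * ennreal (exp (s * direction_tail \<xi> d k (\<psi>(k := \<theta>))))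
        = ennreal (angle_weight d k \<theta> * exp (s * \<xi> k * cos \<theta>)) *
        ((\<Prod>i\<in>{Suc k..d-1}. ennreal (angle_weight d i (\<psi> i))) * ennreal (exp (s * sin \<theta> * direction_tail \<xi> d (Suc k) \<psi>)))"
        by (simp only: ennreal_mult angle_weight_nonneg exp_ge_zero mult_ac)
    qed
    also have "\<dots> = (\<integral>\<^sup>+\<theta>. ennreal (angle_weight d k \<theta> * exp (s * \<xi> k * cos \<theta>)) * (K * hyp01 b ((s * sin \<theta>)\<^sup>2 * ?S / 4)) \<partial>lborel)"
      by (subst nn_integral_cmult) (measurable, simp only: IH b_def)
    also have "\<dots> = (\<integral>\<^sup>+\<theta>. K * (ennreal (sin \<theta> powr (2 * b - 1) * exp (s * \<xi> k * cos \<theta>)) * hyp01 b (s\<^sup>2 * ?S / 4 * (sin \<theta>)\<^sup>2) * indicator {0..pi} \<theta>) \<partial>lborel)"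
    proof (rule nn_integral_cong)
      fix \<theta> :: real
      have "sin \<theta> powr (2 * b - 1) = sin \<theta> ^ (d - 1 - k)" if "\<theta> \<in> {0..pi}"
      proof (cases "sin \<theta> = 0")
        case True
        \<comment> \<open>Since k < d - 1 the exponent is positive, so the natural power of 0
          vanishes just as \<open>powr\<close> does.\<close>
        then show ?thesis using step.hyps by (simp add: b power_0_left)
      next
        case False
        then have "sin \<theta> > 0" using that sin_ge_zero[of \<theta>] by auto
        then show ?thesis by (simp only: b powr_realpow)
      qed
      then show "ennreal (angle_weight d k \<theta> * exp (s * \<xi> k * cos \<theta>)) * (K * hyp01 b ((s * sin \<theta>)\<^sup>2 * ?S / 4))
        = K * (ennreal (sin \<theta> powr (2 * b - 1) * exp (s * \<xi> k * cos \<theta>)) * hyp01 b (s\<^sup>2 * ?S / 4 * (sin \<theta>)\<^sup>2) * indicator {0..pi} \<theta>)"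
        using step.hyps by (auto simp: angle_weight_def indicator_def power_mult_distrib mult_ac)
    qed
    also have "\<dots> = K * (\<integral>\<^sup>+\<theta>. ennreal (sin \<theta> powr (2 * b - 1) * exp (s * \<xi> k * cos \<theta>)) * hyp01 b (s\<^sup>2 * ?S / 4 * (sin \<theta>)\<^sup>2) * indicator {0..pi} \<theta> \<partial>lborel)"
      by (rule nn_integral_cmult) measurable
    also have "\<dots> = K * (ennreal (sqrt pi * Gamma b / Gamma (b + 1/2)) * hyp01 (b + 1/2) (s\<^sup>2 * ?S / 4 + (s * \<xi> k)\<^sup>2 / 4))"
      by (subst hyp01_slice_angle) (auto simp: b(1) sum_nonneg)
    also have "s\<^sup>2 * ?S / 4 + (s * \<xi> k)\<^sup>2 / 4 = s\<^sup>2 * (\<Sum>j\<in>{k..d}. (\<xi> j)\<^sup>2) / 4"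
      using step.hyps by (simp add: sum.atLeast_Suc_atMost power_mult_distrib algebra_simps add_divide_distrib)
    finally show "(\<integral>\<^sup>+\<psi>. (\<Prod>i\<in>{k..d-1}. ennreal (angle_weight d i (\<psi> i))) * ennreal (exp (s * direction_tail \<xi> d k \<psi>)) \<partial>PiM {k..d-1} (\<lambda>_. lborel))
      = K * ennreal (sqrt pi * Gamma b / Gamma (b + 1/2)) * hyp01 (real (d - k + 1) / 2) (s\<^sup>2 * (\<Sum>j\<in>{k..d}. (\<xi> j)\<^sup>2) / 4)"
      by (simp add: b(3) mult.assoc)
  qed
qed

lemma angle_density_eq:
  assumes "d \<ge> 2"
  shows "ennreal (angle_density d \<psi>)
     = ennreal (Gamma (real d / 2) / (2 * pi powr (real d / 2))) * (\<Prod>i\<in>{1..d-1}. ennreal (angle_weight d i (\<psi> i)))"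
proof -
  have I: "{1..d-1} = insert (d - 1) {1..d-2}" using assms by auto
  let ?g = "Gamma (real d / 2) / (2 * pi powr (real d / 2))"
  have "Gamma (real d / 2) > 0" using assms by (intro Gamma_real_pos) auto
  then have g: "?g \<ge> 0" by simp
  have "(\<Prod>i\<in>{1..d-1}. angle_weight d i (\<psi> i)) = indicator {0..2 * pi} (\<psi> (d - 1)) * (\<Prod>i\<in>{1..d-2}. angle_weight d i (\<psi> i))"
    unfolding I using assms by (subst prod.insert) (auto simp: angle_weight_def)
  also have "(\<Prod>i\<in>{1..d-2}. angle_weight d i (\<psi> i)) = (\<Prod>i\<in>{1..d-2}. sin (\<psi> i) ^ (d - 1 - i)) * (\<Prod>i\<in>{1..d-2}. indicator {0..pi} (\<psi> i))"
    unfolding prod.distrib[symmetric] by (intro prod.cong) (auto simp: angle_weight_def)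
  also have "(\<Prod>i\<in>{1..d-2}. indicator {0..pi} (\<psi> i) :: real) = (if \<forall>i\<in>{1..d-2}. 0 \<le> \<psi> i \<and> \<psi> i \<le> pi then 1 else 0)"
    by (auto simp: indicator_def intro!: prod.neutral prod_zero)
  finally have eq: "angle_density d \<psi> = ?g * (\<Prod>i\<in>{1..d-1}. angle_weight d i (\<psi> i))"
    by (auto simp: angle_density_def indicator_def)
  have P: "(\<Prod>i\<in>{1..d-1}. angle_weight d i (\<psi> i)) \<ge> 0"
    by (intro prod_nonneg angle_weight_nonneg)
  show ?thesis
    by (simp only: eq ennreal_mult[OF g P] prod_ennreal angle_weight_nonneg)
qed

text \<open>The normalising constant need not be computed: it is fixed by the total mass.\<close>

lemma mgf_uniform_sphere:
  assumes d: "d \<ge> 2" and prob: "prob_space (uniform_sphere d)"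
  shows "(\<integral>\<^sup>+v. ennreal (exp (\<Sum>k\<in>{1..d}. \<xi> k * v k)) \<partial>uniform_sphere d) = hyp01 (real d / 2) ((\<Sum>k\<in>{1..d}. (\<xi> k)\<^sup>2) / 4)"
proof -
  let ?L = "PiM {1..d-1} (\<lambda>_. lborel :: real measure)"
  let ?g = "ennreal (Gamma (real d / 2) / (2 * pi powr (real d / 2)))"
  have "1 \<le> d - 1" "real (d - 1 + 1) / 2 = real d / 2" using d by auto
  from nn_integral_direction_tail[OF order_refl this(1), of \<xi>, unfolded this(2)]
  obtain K where K: "\<And>s. (\<integral>\<^sup>+\<psi>. (\<Prod>i\<in>{1..d-1}. ennreal (angle_weight d i (\<psi> i))) * ennreal (exp (s * direction_tail \<xi> d 1 \<psi>)) \<partial>?L)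
     = K * hyp01 (real d / 2) (s\<^sup>2 * (\<Sum>j\<in>{1..d}. (\<xi> j)\<^sup>2) / 4)"
    by blast
  have [measurable]: "(\<lambda>v. ennreal (exp (s * (\<Sum>k\<in>{1..d}. \<xi> k * v k)))) \<in> borel_measurable (PiM {1..d} (\<lambda>_. borel))" for s
    by measurable
  have [measurable]: "(\<lambda>\<psi>. ennreal (angle_density d \<psi>)) \<in> borel_measurable ?L"
    unfolding angle_density_eq[OF d] by measurable
  have sum: "(\<Sum>k\<in>{1..d}. \<xi> k * hyperspherical d \<psi> k) = direction_tail \<xi> d 1 \<psi>" for \<psi>
    unfolding direction_tail_def hyperspherical_def by (intro sum.cong) auto
  have int: "(\<integral>\<^sup>+v. ennreal (exp (s * (\<Sum>k\<in>{1..d}. \<xi> k * v k))) \<partial>uniform_sphere d) = ?g * (K * hyp01 (real d / 2) (s\<^sup>2 * (\<Sum>j\<in>{1..d}. (\<xi> j)\<^sup>2) / 4))" for s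
  proof -
    have "(\<integral>\<^sup>+v. ennreal (exp (s * (\<Sum>k\<in>{1..d}. \<xi> k * v k))) \<partial>uniform_sphere d)
       = (\<integral>\<^sup>+\<psi>. ennreal (exp (s * (\<Sum>k\<in>{1..d}. \<xi> k * hyperspherical d \<psi> k))) \<partial>density ?L (\<lambda>\<psi>. ennreal (angle_density d \<psi>)))"
      unfolding uniform_sphere_def by (rule nn_integral_distr) measurable
    also have "\<dots> = (\<integral>\<^sup>+\<psi>. ennreal (angle_density d \<psi>) * ennreal (exp (s * direction_tail \<xi> d 1 \<psi>)) \<partial>?L)"
      unfolding sum by (rule nn_integral_density) measurable
    also have "\<dots> = (\<integral>\<^sup>+\<psi>. ?g * ((\<Prod>i\<in>{1..d-1}. ennreal (angle_weight d i (\<psi> i))) * ennreal (exp (s * direction_tail \<xi> d 1 \<psi>))) \<partial>?L)"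
      by (simp only: angle_density_eq[OF d] mult.assoc)
    also have "\<dots> = ?g * (\<integral>\<^sup>+\<psi>. (\<Prod>i\<in>{1..d-1}. ennreal (angle_weight d i (\<psi> i))) * ennreal (exp (s * direction_tail \<xi> d 1 \<psi>)) \<partial>?L)"
      by (rule nn_integral_cmult) measurable
    finally show ?thesis unfolding K .
  qed
  have "?g * K = 1"
    using int[of 0] prob_space.emeasure_space_1[OF prob] by simp
  then show ?thesis
    using int[of 1] by (simp add: mult.assoc[symmetric])
qed

subsection \<open>Dirichlet distributed durations\<close>

text \<open>The Cauchy product identity that makes a family \<open>q\<close> of parameters of $_0F_1$ compatible with
  convolution. It holds for \<open>q a = (a + 1) / 2\<close> by Vandermonde and for \<open>q a = a + 1\<close> by Rothe-Hagen.\<close>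

definition convolution_family :: "(real \<Rightarrow> real) \<Rightarrow> bool" where
  "convolution_family q \<longleftrightarrow> (\<forall>a>0. q a > 0) \<and>
     (\<forall>a>0. \<forall>b>0. \<forall>N. (\<Sum>i\<le>N. pochhammer a (2 * i) / (fact i * pochhammer (q a) i) *
                (pochhammer b (2 * (N - i)) / (fact (N - i) * pochhammer (q b) (N - i))))
              = pochhammer (a + b) (2 * N) / (fact N * pochhammer (q (a + b)) N))"

text \<open>The duplication formula (a)_{2i} = 4^i (a/2)_i ((a+1)/2)_i cancels the denominator and
  leaves 4^i (a/2)_i / i!, the coefficients of (1 - 4x)^(-a/2). The identity says that such powers
  multiply by adding exponents.\<close>

lemma convolution_family_half: "convolution_family (\<lambda>a. (a + 1) / 2)"
  unfolding convolution_family_def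
proof (intro conjI allI impI)
  fix a b :: real and N :: nat
  assume ab: "a > 0" "b > 0"
  have coeff: "pochhammer a (2 * i) / (fact i * pochhammer ((a + 1) / 2) i) = 4 ^ i * pochhammer (a / 2) i / fact i"
    if "a > 0" for a :: real and i
  proof -
    have "pochhammer ((a + 1) / 2) i > 0" using that by (intro pochhammer_pos) auto
    then show ?thesis
      using pochhammer_double[of "a / 2" i] by (simp add: add_divide_distrib power_mult)
  qed
  have "(\<Sum>i\<le>N. 4 ^ i * pochhammer (a / 2) i / fact i * (4 ^ (N - i) * pochhammer (b / 2) (N - i) / fact (N - i)))
     = (\<Sum>i\<le>N. 4 ^ N / fact N * (real (N choose i) * pochhammer (a / 2) i * pochhammer (b / 2) (N - i)))"
  proof (intro sum.cong refl)
    fix i assume i: "i \<in> {..N}"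
    have "(4::real) ^ N = 4 ^ i * 4 ^ (N - i)" using i by (simp flip: power_add)
    moreover have "real (N choose i) / fact N = 1 / (fact i * fact (N - i))" using i by (simp add: binomial_fact)
    ultimately show "4 ^ i * pochhammer (a / 2) i / fact i * (4 ^ (N - i) * pochhammer (b / 2) (N - i) / fact (N - i))
      = 4 ^ N / fact N * (real (N choose i) * pochhammer (a / 2) i * pochhammer (b / 2) (N - i))"
      using i by (simp add: field_simps)
  qed
  also have "\<dots> = 4 ^ N * pochhammer ((a + b) / 2) N / fact N"
    unfolding sum_distrib_left[symmetric] pochhammer_binomial_sum[symmetric] by (simp add: add_divide_distrib)
  finally show "(\<Sum>i\<le>N. pochhammer a (2 * i) / (fact i * pochhammer ((a + 1) / 2) i) *
                (pochhammer b (2 * (N - i)) / (fact (N - i) * pochhammer ((b + 1) / 2) (N - i))))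
              = pochhammer (a + b) (2 * N) / (fact N * pochhammer ((a + b + 1) / 2) N)"
    using ab by (simp only: coeff add_pos_pos)
qed auto

section \<open>The Rothe-Hagen identity\<close>

text \<open>The polynomial in \<open>a\<close> that is written $\frac{a}{a+2k}\binom{a+2k}{k}$ in the Rothe-Hagen identity.\<close>

fun rothe :: "nat \<Rightarrow> real \<Rightarrow> real" where
  "rothe 0 a = 1"
| "rothe (Suc k) a = a * pochhammer (a + real k + 2) k / fact (Suc k)"

text \<open>For k = j + 1 the symbol (a)_{2k} splits as a (a+1)_k (a+j+2)_j, so the denominator
  cancels. The quotient thereby becomes a polynomial in a, as the interpolation argument for
  \<open>rothe_hagen\<close> requires.\<close>

lemma rothe_eq:
  assumes "a > 0"
  shows "pochhammer a (2 * k) / (fact k * pochhammer (a + 1) k) = rothe k a"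
proof (cases k)
  case (Suc j)
  have "pochhammer a (2 * k) = a * pochhammer (a + 1) (k + j)"
    using Suc pochhammer_rec[of a "Suc (2 * j)"] by (simp add: mult_2)
  also have "\<dots> = a * (pochhammer (a + 1) k * pochhammer (a + real j + 2) j)"
    using pochhammer_product'[of "a + 1" k j] Suc by (simp add: add_ac)
  finally have "pochhammer a (2 * k) = a * pochhammer (a + real j + 2) j * pochhammer (a + 1) k" by simp
  moreover have "pochhammer (a + 1) k > 0" using assms by (intro pochhammer_pos) auto
  ultimately show ?thesis using Suc by simp
qed simp

lemma rothe_0_right: "rothe k 0 = (if k = 0 then 1 else 0)"
  by (cases k) auto

text \<open>In terms of generating functions: the \<open>rothe k a\<close> are the coefficients of
  B(x)^a, where B = 1 + x B^2 is the Catalan series, and this is the coefficient form of B^(a+1) -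
  B^a = x B^(a+2).\<close>

lemma rothe_diff: "rothe (Suc k) (a + 1) - rothe (Suc k) a = rothe k (a + 2)"
proof (cases k)
  case (Suc j)
  define P where "P = pochhammer (a + real j + 4) j"
  have P1: "pochhammer (a + 1 + real k + 2) k = P * (a + 2 * real j + 4)"
    using pochhammer_Suc[of "a + real j + 4" j] by (simp add: Suc P_def algebra_simps)
  have P2: "pochhammer (a + real k + 2) k = (a + real j + 3) * P"
    using pochhammer_rec[of "a + real j + 3" j] by (simp add: Suc P_def algebra_simps)
  have P3: "pochhammer (a + 2 + real j + 2) j = P"
    by (simp add: P_def algebra_simps)
  have "rothe (Suc k) (a + 1) - rothe (Suc k) a = ((a + 1) * (P * (a + 2 * real j + 4)) - a * ((a + real j + 3) * P)) / fact (Suc k)"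
    unfolding rothe.simps P1 P2 by (simp only: diff_divide_distrib)
  also have "(a + 1) * (P * (a + 2 * real j + 4)) - a * ((a + real j + 3) * P) = real (Suc k) * ((a + 2) * P)"
    by (simp add: Suc algebra_simps)
  also have "real (Suc k) * ((a + 2) * P) / fact (Suc k) = (a + 2) * P / fact k"
    by (simp only: fact_Suc of_nat_mult) (simp del: of_nat_Suc)
  finally show ?thesis
    unfolding Suc rothe.simps P3 .
qed simp

lemma poly_pochhammer: "\<exists>p. \<forall>a::real. poly p a = pochhammer (a + c) n"
proof (induction n)
  case (Suc n)
  then obtain p where "\<And>a. poly p a = pochhammer (a + c) n" by auto
  then have "\<forall>a. poly (p * [:c + real n, 1:]) a = pochhammer (a + c) (Suc n)"
    by (simp add: pochhammer_Suc algebra_simps)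
  then show ?case by blast
qed (auto intro: exI[of _ 1])

lemma poly_rothe: "\<exists>p. \<forall>a. poly p (a::real) = rothe k (a + c)"
proof (cases k)
  case (Suc j)
  obtain p where p: "\<And>a::real. poly p a = pochhammer (a + (c + real j + 2)) j"
    using poly_pochhammer by blast
  have "\<forall>a. poly (smult (1 / fact (Suc j)) ([:c, 1:] * p)) a = rothe k (a + c)"
    by (simp add: p Suc algebra_simps add_divide_distrib del: fact_Suc)
  then show ?thesis by blast
qed (auto intro: exI[of _ 1])

text \<open>For fixed b the defect \<open>g\<close> of the identity is a polynomial in a. By
  \<open>rothe_diff\<close> its increment from a to a + 1 is the defect at N with a + 2 in place of
  a, which is 0 by induction. As it vanishes at a = 0, it vanishes at all natural numbers and hence
  identically.\<close>

lemma rothe_hagen: "(\<Sum>i\<le>N. rothe i a * rothe (N - i) b) = rothe N (a + b)"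
proof (induction N arbitrary: a b)
  case (Suc N)
  define g where "g a = (\<Sum>i\<le>Suc N. rothe i a * rothe (Suc N - i) b) - rothe (Suc N) (a + b)" for a
  have step: "g (a + 1) = g a" for a
  proof -
    have "g (a + 1) - g a = (\<Sum>i\<le>Suc N. (rothe i (a + 1) - rothe i a) * rothe (Suc N - i) b)
        - (rothe (Suc N) ((a + b) + 1) - rothe (Suc N) (a + b))"
      unfolding g_def by (simp only: sum_subtractf left_diff_distrib) (simp add: add_ac)
    also have "\<dots> = (\<Sum>i\<le>N. rothe i (a + 2) * rothe (N - i) b) - rothe N (a + b + 2)"
      by (simp only: rothe_diff sum.atMost_Suc_shift) (simp add: rothe_diff)
    also have "\<dots> = 0"
      using Suc[of "a + 2" b] by (simp add: add_ac)
    finally show ?thesis by simp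
  qed
  have "g 0 = 0"
    unfolding g_def sum.atMost_Suc_shift by (simp add: rothe_0_right)
  then have zeros: "g (real n) = 0" for n
    by (induction n) (use step in \<open>simp_all add: add.commute[of 1]\<close>)
  obtain p where p: "\<And>i a. poly (p i) a = rothe i (a + 0)"
    using poly_rothe[of _ 0] by metis
  obtain r where r: "\<And>a. poly r a = rothe (Suc N) (a + b)"
    using poly_rothe by blast
  define G where "G = (\<Sum>i\<le>Suc N. smult (rothe (Suc N - i) b) (p i)) - r"
  have G: "poly G a = g a" for a
    by (simp only: G_def g_def poly_diff poly_sum poly_smult p r add_0_right mult.commute)
  have "range real \<subseteq> {x. poly G x = 0}"
    using zeros by (auto simp: G)
  moreover have "infinite (range real)"
    using infinite_UNIV_nat by (simp add: finite_image_iff)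
  ultimately have "G = 0"
    using poly_roots_finite finite_subset by blast
  then have "g a = 0" for a using G by simp
  then show ?case by (simp only: g_def right_minus_eq)
qed simp

lemma convolution_family_plus_one: "convolution_family (\<lambda>a. a + 1)"
  unfolding convolution_family_def by (auto simp: rothe_eq rothe_hagen)

text \<open>Dirichlet's iterated integral: fixing one duration y leaves a simplex of total time T -
  y, so each variable costs one convolution, which adds a to the accumulated exponent b. Including T
  \<le> 0 with value 0 lets the induction hypothesis apply for all y. Each Beta factor replaces
  Gamma b by Gamma (a + b) in the denominator.\<close>

lemma nn_integral_simplex_hyp01:
  fixes a \<kappa> T :: real and I :: "'i set"
  assumes q: "convolution_family q" and a: "a > 0" and \<kappa>: "\<kappa> \<ge> 0" and "finite I"
  defines "G \<equiv> \<lambda>s. ennreal (s powr (a - 1)) * hyp01 (q a) (\<kappa> * s\<^sup>2)"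
  shows "(\<integral>\<^sup>+s. (if (\<forall>j\<in>I. 0 < s j) \<and> (\<Sum>j\<in>I. s j) < T then (\<Prod>j\<in>I. G (s j)) * G (T - (\<Sum>j\<in>I. s j)) else 0) \<partial>PiM I (\<lambda>_. lborel))
     = (if 0 < T then ennreal (Gamma a ^ (card I + 1) / Gamma ((real (card I) + 1) * a) * T powr ((real (card I) + 1) * a - 1))
          * hyp01 (q ((real (card I) + 1) * a)) (\<kappa> * T\<^sup>2) else 0)"
  using \<open>finite I\<close>
proof (induction I arbitrary: T rule: finite_induct)
  case empty
  have "Gamma a \<noteq> 0" using Gamma_real_pos[OF a] by simp
  then show ?case by (simp add: nn_integral_count_space_finite PiM_empty G_def)
next
  case (insert i I)
  have [measurable]: "G \<in> borel_measurable borel" unfolding G_def by measurable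
  define b where "b = (real (card I) + 1) * a"
  define C where "C = Gamma a ^ (card I + 1) / Gamma b"
  have b: "b > 0" using a by (simp add: b_def add_nonneg_pos)
  have ab: "a + b = (real (card (insert i I)) + 1) * a"
    using insert by (simp add: b_def algebra_simps)
  have C: "C \<ge> 0" using a b by (simp add: C_def Gamma_real_pos less_imp_le)
  let ?f = "\<lambda>I T s. if (\<forall>j\<in>I. 0 < s j) \<and> (\<Sum>j\<in>I. s j) < T then (\<Prod>j\<in>I. G (s j)) * G (T - (\<Sum>j\<in>I. s j)) else 0"
  have [measurable]: "?f I T \<in> borel_measurable (PiM I (\<lambda>_. lborel))" if "finite I" for I :: "'i set" and T
    using that by measurable
  have "(\<integral>\<^sup>+s. ?f (insert i I) T s \<partial>PiM (insert i I) (\<lambda>_. lborel))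
    = (\<integral>\<^sup>+y. \<integral>\<^sup>+s. ?f (insert i I) T (s(i := y)) \<partial>PiM I (\<lambda>_. lborel) \<partial>lborel)"
    using insert(1,2) by (intro lborel_PiM.product_nn_integral_insert_rev) auto
  also have "\<dots> = (\<integral>\<^sup>+y. \<integral>\<^sup>+s. (G y * indicator {0<..} y) * ?f I (T - y) s \<partial>PiM I (\<lambda>_. lborel) \<partial>lborel)"
  proof (intro nn_integral_cong)
    fix y :: real and s :: "'i \<Rightarrow> real"
    have upd: "(\<Sum>j\<in>I. (s(i := y)) j) = (\<Sum>j\<in>I. s j)" "(\<Prod>j\<in>I. G ((s(i := y)) j)) = (\<Prod>j\<in>I. G (s j))"
      "(\<forall>j\<in>I. 0 < (s(i := y)) j) \<longleftrightarrow> (\<forall>j\<in>I. 0 < s j)"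
      using insert by (auto intro!: sum.cong prod.cong)
    have "(\<Sum>j\<in>insert i I. (s(i := y)) j) = y + (\<Sum>j\<in>I. s j)"
      "(\<Prod>j\<in>insert i I. G ((s(i := y)) j)) = G y * (\<Prod>j\<in>I. G (s j))"
      "(\<forall>j\<in>insert i I. 0 < (s(i := y)) j) \<longleftrightarrow> 0 < y \<and> (\<forall>j\<in>I. 0 < s j)"
      using insert(1,2) upd by simp_all
    moreover have "y + (\<Sum>j\<in>I. s j) < T \<longleftrightarrow> (\<Sum>j\<in>I. s j) < T - y"
      "T - (y + (\<Sum>j\<in>I. s j)) = T - y - (\<Sum>j\<in>I. s j)" by auto
    ultimately show "?f (insert i I) T (s(i := y)) = (G y * indicator {0<..} y) * ?f I (T - y) s"
      by (simp only:) (auto simp: indicator_def mult.assoc)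
  qed
  also have "\<dots> = (\<integral>\<^sup>+y. (G y * indicator {0<..} y) * (\<integral>\<^sup>+s. ?f I (T - y) s \<partial>PiM I (\<lambda>_. lborel)) \<partial>lborel)"
    using insert(1) by (intro nn_integral_cong nn_integral_cmult) auto
  also have "\<dots> = (\<integral>\<^sup>+y. (G y * indicator {0<..} y) * (if 0 < T - y then ennreal (C * (T - y) powr (b - 1)) * hyp01 (q b) (\<kappa> * (T - y)\<^sup>2) else 0) \<partial>lborel)"
    unfolding insert.IH b_def[symmetric] C_def ..
  also have "\<dots> = (\<integral>\<^sup>+y. ennreal C * (ennreal (y powr (a - 1)) * hyp01 (q a) (\<kappa> * y\<^sup>2) *
            (ennreal ((T - y) powr (b - 1)) * hyp01 (q b) (\<kappa> * (T - y)\<^sup>2)) * indicator {0<..<T} y) \<partial>lborel)"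
    by (intro nn_integral_cong) (auto simp: G_def indicator_def ennreal_mult C mult_ac)
  also have "\<dots> = ennreal C * (\<integral>\<^sup>+y. ennreal (y powr (a - 1)) * hyp01 (q a) (\<kappa> * y\<^sup>2) *
            (ennreal ((T - y) powr (b - 1)) * hyp01 (q b) (\<kappa> * (T - y)\<^sup>2)) * indicator {0<..<T} y \<partial>lborel)"
    by (rule nn_integral_cmult) measurable
  also have "\<dots> = (if 0 < T then ennreal C * (ennreal (Beta a b * T powr (a + b - 1)) * hyp01 (q (a + b)) (\<kappa> * T\<^sup>2)) else 0)"
  proof (cases "T > 0")
    case True
    then show ?thesis
      using q a b \<kappa> unfolding convolution_family_def by (subst hyp01_convolution[where qc="q (a + b)"]) auto
  qed simp
  also have "ennreal C * (ennreal (Beta a b * T powr (a + b - 1)) * hyp01 (q (a + b)) (\<kappa> * T\<^sup>2))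
     = ennreal (Gamma a ^ (card (insert i I) + 1) / Gamma (a + b) * T powr (a + b - 1)) * hyp01 (q (a + b)) (\<kappa> * T\<^sup>2)"
  proof -
    have G: "Gamma a > 0" "Gamma b > 0" "Gamma (a + b) > 0" using a b by (auto intro!: Gamma_real_pos)
    then have "C * (Beta a b * T powr (a + b - 1)) = Gamma a ^ (card (insert i I) + 1) / Gamma (a + b) * T powr (a + b - 1)"
      using insert(1,2) by (simp add: C_def Beta_def)
    moreover have "Beta a b * T powr (a + b - 1) \<ge> 0" using G by (simp add: Beta_def)
    ultimately show ?thesis using ennreal_mult[OF C] by (metis mult.assoc)
  qed
  finally show ?case unfolding ab .
qed

subsection \<open>Random flights\<close>

text \<open>This turns independence of the generated sigma-algebras, the form in which the locale
  states it, into a product law, the form needed to condition on the durations by Fubini.\<close>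

lemma (in prob_space) distr_pair_eq_if_indep_set:
  assumes [measurable]: "X \<in> M \<rightarrow>\<^sub>M S" "Y \<in> M \<rightarrow>\<^sub>M T"
    and indep: "indep_set (sets (vimage_algebra (space M) X S)) (sets (vimage_algebra (space M) Y T))"
  shows "distr M (S \<Otimes>\<^sub>M T) (\<lambda>\<omega>. (X \<omega>, Y \<omega>)) = distr M S X \<Otimes>\<^sub>M distr M T Y"
proof (rule pair_measure_eqI[symmetric])
  interpret X: prob_space "distr M S X" by (rule prob_space_distr) measurable
  interpret Y: prob_space "distr M T Y" by (rule prob_space_distr) measurable
  show "sigma_finite_measure (distr M S X)" "sigma_finite_measure (distr M T Y)" by unfold_locales
  show "sets (distr M S X \<Otimes>\<^sub>M distr M T Y) = sets (distr M (S \<Otimes>\<^sub>M T) (\<lambda>\<omega>. (X \<omega>, Y \<omega>)))"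
    by (simp cong: sets_pair_measure_cong)
  fix A B assume "A \<in> sets (distr M S X)" "B \<in> sets (distr M T Y)"
  then have [measurable]: "A \<in> sets S" "B \<in> sets T" by auto
  have "prob ((X -` A \<inter> space M) \<inter> (Y -` B \<inter> space M)) = prob (X -` A \<inter> space M) * prob (Y -` B \<inter> space M)"
    by (rule indep_setD[OF indep]) (auto intro: in_vimage_algebra)
  moreover have "(\<lambda>\<omega>. (X \<omega>, Y \<omega>)) -` (A \<times> B) \<inter> space M = (X -` A \<inter> space M) \<inter> (Y -` B \<inter> space M)" by auto
  ultimately show "emeasure (distr M S X) A * emeasure (distr M T Y) B = emeasure (distr M (S \<Otimes>\<^sub>M T) (\<lambda>\<omega>. (X \<omega>, Y \<omega>))) (A \<times> B)"
    by (simp add: emeasure_distr emeasure_eq_measure ennreal_mult)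
qed

lemma measurable_durations [measurable]:
  assumes "j \<in> {1..n+1}"
  shows "(\<lambda>s. durations n t s j) \<in> borel_measurable (PiM {1..n} (\<lambda>_. borel))"
proof (cases "j = n + 1")
  case False
  then have "j \<in> {1..n}" using assms by auto
  then show ?thesis using False unfolding durations_def by simp
next
  case True
  then show ?thesis unfolding durations_def by simp measurable
qed

text \<open>The Dirichlet weight supplies one power with exponent a - 1 to each of the n + 1
  factors, the last one at the remaining time. Its normalising constant is the inverse of the one in
  \<open>nn_integral_simplex_hyp01\<close>, so a pure 0F1 is left.\<close>

lemma nn_integral_dirichlet_hyp01:
  assumes q: "convolution_family q" and a: "a > 0" and t: "t > 0" and \<kappa>: "\<kappa> \<ge> 0"
  shows "(\<integral>\<^sup>+s. ennreal (dirichlet_density a n t s) * (\<Prod>j\<in>{1..n+1}. hyp01 (q a) (\<kappa> * (durations n t s j)\<^sup>2)) \<partial>PiM {1..n} (\<lambda>_. lborel))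
     = hyp01 (q ((real n + 1) * a)) (\<kappa> * t\<^sup>2)"
proof -
  define b where "b = (real n + 1) * a"
  have b: "b > 0" using a by (simp add: b_def add_nonneg_pos)
  have G: "Gamma a > 0" "Gamma b > 0" using a b by (auto intro!: Gamma_real_pos)
  define K where "K = Gamma b / Gamma a ^ (n + 1) * (1 / t powr (b - 1))"
  have K: "K \<ge> 0" using G by (simp add: K_def)
  let ?G = "\<lambda>s. ennreal (s powr (a - 1)) * hyp01 (q a) (\<kappa> * s\<^sup>2)"
  let ?f = "\<lambda>s. if (\<forall>j\<in>{1..n}. 0 < s j) \<and> (\<Sum>j\<in>{1..n}. s j) < t then (\<Prod>j\<in>{1..n}. ?G (s j)) * ?G (t - (\<Sum>j\<in>{1..n}. s j)) else 0"
  have "ennreal (dirichlet_density a n t s) * (\<Prod>j\<in>{1..n+1}. hyp01 (q a) (\<kappa> * (durations n t s j)\<^sup>2)) = ennreal K * ?f s" for s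
  proof (cases "(\<forall>j\<in>{1..n}. 0 < s j) \<and> (\<Sum>j\<in>{1..n}. s j) < t")
    case True
    have "ennreal (dirichlet_density a n t s) = ennreal K * ennreal (\<Prod>j\<in>{1..n+1}. durations n t s j powr (a - 1))"
      using True K by (simp add: dirichlet_density_def K_def b_def prod_nonneg flip: ennreal_mult)
    also have "ennreal (\<Prod>j\<in>{1..n+1}. durations n t s j powr (a - 1)) = (\<Prod>j\<in>{1..n+1}. ennreal (durations n t s j powr (a - 1)))"
      by (rule prod_ennreal[symmetric]) simp
    finally have "ennreal (dirichlet_density a n t s) * (\<Prod>j\<in>{1..n+1}. hyp01 (q a) (\<kappa> * (durations n t s j)\<^sup>2))
      = ennreal K * (\<Prod>j\<in>{1..n+1}. ?G (durations n t s j))"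
      by (simp only: prod.distrib mult.assoc)
    also have "(\<Prod>j\<in>{1..n+1}. ?G (durations n t s j)) = (\<Prod>j\<in>{1..n}. ?G (s j)) * ?G (t - (\<Sum>j\<in>{1..n}. s j))"
    proof -
      have "(\<Prod>j\<in>{1..n}. ?G (durations n t s j)) = (\<Prod>j\<in>{1..n}. ?G (s j))"
        by (intro prod.cong refl) (simp add: durations_def)
      moreover have "durations n t s (n + 1) = t - (\<Sum>j\<in>{1..n}. s j)" by (simp add: durations_def)
      moreover have "{1..n+1} = insert (n + 1) {1..n}" by auto
      ultimately show ?thesis by (simp add: mult.commute)
    qed
    finally show ?thesis using True by simp
  next
    case False
    then show ?thesis by (auto simp: dirichlet_density_def)
  qed
  then have "(\<integral>\<^sup>+s. ennreal (dirichlet_density a n t s) * (\<Prod>j\<in>{1..n+1}. hyp01 (q a) (\<kappa> * (durations n t s j)\<^sup>2)) \<partial>PiM {1..n} (\<lambda>_. lborel))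
    = (\<integral>\<^sup>+s. ennreal K * ?f s \<partial>PiM {1..n} (\<lambda>_. lborel))" by simp
  also have "\<dots> = ennreal K * (\<integral>\<^sup>+s. ?f s \<partial>PiM {1..n} (\<lambda>_. lborel))"
    by (rule nn_integral_cmult) measurable
  also have "(\<integral>\<^sup>+s. ?f s \<partial>PiM {1..n} (\<lambda>_. lborel)) = ennreal (Gamma a ^ (n + 1) / Gamma b * t powr (b - 1)) * hyp01 (q b) (\<kappa> * t\<^sup>2)"
    using nn_integral_simplex_hyp01[OF q a \<kappa>, of "{1..n}" t] t by (simp add: b_def)
  also have "ennreal K * (ennreal (Gamma a ^ (n + 1) / Gamma b * t powr (b - 1)) * hyp01 (q b) (\<kappa> * t\<^sup>2))
     = ennreal (K * (Gamma a ^ (n + 1) / Gamma b * t powr (b - 1))) * hyp01 (q b) (\<kappa> * t\<^sup>2)"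
  proof -
    have "Gamma a ^ (n + 1) / Gamma b * t powr (b - 1) \<ge> 0" using G by simp
    then show ?thesis by (simp only: ennreal_mult[OF K] mult.assoc)
  qed
  also have "K * (Gamma a ^ (n + 1) / Gamma b * t powr (b - 1)) = 1"
    using G t by (simp add: K_def)
  finally show ?thesis by (simp add: b_def)
qed

lemma ennreal_exp_sum:
  fixes g :: "'i \<Rightarrow> real"
  assumes "finite J"
  shows "ennreal (exp (\<Sum>j\<in>J. g j)) = (\<Prod>j\<in>J. ennreal (exp (g j)))"
  using assms by (simp add: exp_sum prod_ennreal)

context random_flight
begin

abbreviation "direction_space \<equiv> PiM {1..d} (\<lambda>_. borel :: real measure)"
abbreviation "directions \<equiv> (\<lambda>\<omega>. \<lambda>j\<in>{1..n+1}. V j \<omega>)"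

lemma measurable_times: "\<tau> \<in> M \<rightarrow>\<^sub>M PiM {1..n} (\<lambda>_. borel)"
proof -
  have "\<tau> \<in> M \<rightarrow>\<^sub>M PiM {1..n} (\<lambda>_. lborel)"
    using distributed_times by (rule distributed_measurable)
  also have "(M \<rightarrow>\<^sub>M PiM {1..n} (\<lambda>_. lborel :: real measure)) = (M \<rightarrow>\<^sub>M PiM {1..n} (\<lambda>_. borel))"
    by (intro measurable_cong_sets sets_PiM_cong) auto
  finally show ?thesis .
qed

lemma measurable_direction: "j \<in> {1..n+1} \<Longrightarrow> V j \<in> M \<rightarrow>\<^sub>M direction_space"
  using indep_directions by (auto simp: indep_vars_def)

lemma measurable_directions: "directions \<in> M \<rightarrow>\<^sub>M PiM {1..n+1} (\<lambda>_. direction_space)"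
  by (rule measurable_restrict) (rule measurable_direction)

lemma prob_space_uniform_sphere: "prob_space (uniform_sphere d)"
  using prob_space_distr[OF measurable_direction[of 1]] distr_direction[of 1] by simp

lemma distr_directions:
  "distr M (PiM {1..n+1} (\<lambda>_. direction_space)) directions = PiM {1..n+1} (\<lambda>_. uniform_sphere d)"
proof -
  have "indep_vars (\<lambda>_. direction_space) V {1..n+1} \<longleftrightarrow>
      distr M (PiM {1..n+1} (\<lambda>_. direction_space)) directions = PiM {1..n+1} (\<lambda>j. distr M direction_space (V j))"
    by (rule indep_vars_iff_distr_eq_PiM') (simp, rule measurable_direction)
  with indep_directions
  have "distr M (PiM {1..n+1} (\<lambda>_. direction_space)) directions = PiM {1..n+1} (\<lambda>j. distr M direction_space (V j))"
    by blast
  also have "\<dots> = PiM {1..n+1} (\<lambda>_. uniform_sphere d)"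
    by (rule PiM_cong) (rule refl, rule distr_direction)
  finally show ?thesis .
qed

text \<open>For given durations the exponential factorises over the directions, whatever the law f
  of the durations is. Rotational symmetry shows in that \<xi> enters only through \<kappa> = c^2
  |\<xi>|^2 / 4, the constant of the convolution lemmas.\<close>

lemma mgf_flight_position:
  assumes d: "d \<ge> 2" and fm: "(\<lambda>s. ennreal (f s)) \<in> borel_measurable (PiM {1..n} (\<lambda>_. lborel))"
  shows "(\<integral>\<^sup>+\<omega>. ennreal (exp (\<Sum>k\<in>{1..d}. \<xi> k * flight_position d n c t V \<tau> \<omega> k)) \<partial>M)
     = (\<integral>\<^sup>+s. ennreal (f s) * (\<Prod>j\<in>{1..n+1}. hyp01 (real d / 2) (c\<^sup>2 * (\<Sum>k\<in>{1..d}. (\<xi> k)\<^sup>2) / 4 * (durations n t s j)\<^sup>2)) \<partial>PiM {1..n} (\<lambda>_. lborel))"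
proof -
  let ?S = "PiM {1..n} (\<lambda>_. borel :: real measure)" and ?T = "PiM {1..n+1} (\<lambda>_. direction_space)"
  let ?U = "PiM {1..n+1} (\<lambda>_. uniform_sphere d)"
  interpret U: prob_space "uniform_sphere d" by (rule prob_space_uniform_sphere)
  interpret PU: product_prob_space "\<lambda>_::nat. uniform_sphere d" by standard
  have sets_U [measurable_cong]: "sets (uniform_sphere d) = sets direction_space"
    by (simp add: uniform_sphere_def)
  have sets_PU: "sets ?U = sets ?T"
    by (intro sets_PiM_cong sets_U refl)
  \<comment> \<open>The scalar c times the j-th duration is moved into the frequency, so that each
    factor is the transform of a single direction and the integral over the product of the sphere
    laws becomes a product.\<close>
  define h where "h s v = (\<Prod>j\<in>{1..n+1}. ennreal (exp (\<Sum>k\<in>{1..d}. (c * durations n t s j * \<xi> k) * v j k)))"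
    for s :: "nat \<Rightarrow> real" and v :: "nat \<Rightarrow> nat \<Rightarrow> real"
  have comp: "(\<lambda>x. snd x j k) \<in> borel_measurable (?S \<Otimes>\<^sub>M ?T)" if "j \<in> {1..n+1}" "k \<in> {1..d}" for j k
    by (rule measurable_compose[OF measurable_compose[OF measurable_snd measurable_component_singleton[OF that(1)]]
          measurable_component_singleton[OF that(2)]])
  have dur: "(\<lambda>x. durations n t (fst x) j) \<in> borel_measurable (?S \<Otimes>\<^sub>M ?T)" if "j \<in> {1..n+1}" for j
    by (rule measurable_compose[OF measurable_fst measurable_durations[OF that]])
  have h_meas: "(\<lambda>x. h (fst x) (snd x)) \<in> borel_measurable (?S \<Otimes>\<^sub>M ?T)"
    unfolding h_def
    by (intro borel_measurable_prod_ennreal measurable_compose[OF _ measurable_ennreal] measurable_compose[OF _ borel_measurable_exp]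
          borel_measurable_sum borel_measurable_times borel_measurable_const comp dur)
  have h: "ennreal (exp (\<Sum>k\<in>{1..d}. \<xi> k * flight_position d n c t V \<tau> \<omega> k)) = h (\<tau> \<omega>) (directions \<omega>)" for \<omega>
  proof -
    have "(\<Sum>k\<in>{1..d}. \<xi> k * flight_position d n c t V \<tau> \<omega> k)
      = (\<Sum>k\<in>{1..d}. \<Sum>j\<in>{1..n+1}. (c * durations n t (\<tau> \<omega>) j * \<xi> k) * directions \<omega> j k)"
      unfolding flight_position_def
      by (intro sum.cong refl) (simp add: sum_distrib_left algebra_simps)
    also have "\<dots> = (\<Sum>j\<in>{1..n+1}. \<Sum>k\<in>{1..d}. (c * durations n t (\<tau> \<omega>) j * \<xi> k) * directions \<omega> j k)"
      by (rule sum.swap)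
    finally show ?thesis
      unfolding h_def by (simp only: ennreal_exp_sum[OF finite_atLeastAtMost])
  qed
  have inner: "(\<integral>\<^sup>+v. h s v \<partial>?U) = (\<Prod>j\<in>{1..n+1}. hyp01 (real d / 2) (c\<^sup>2 * (\<Sum>k\<in>{1..d}. (\<xi> k)\<^sup>2) / 4 * (durations n t s j)\<^sup>2))" for s
  proof -
    have "(\<integral>\<^sup>+v. h s v \<partial>?U) = (\<Prod>j\<in>{1..n+1}. \<integral>\<^sup>+v. ennreal (exp (\<Sum>k\<in>{1..d}. (c * durations n t s j * \<xi> k) * v k)) \<partial>uniform_sphere d)"
      unfolding h_def by (rule PU.product_nn_integral_prod) (simp, measurable)
    also have "\<dots> = (\<Prod>j\<in>{1..n+1}. hyp01 (real d / 2) (c\<^sup>2 * (\<Sum>k\<in>{1..d}. (\<xi> k)\<^sup>2) / 4 * (durations n t s j)\<^sup>2))"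
    proof (intro prod.cong refl)
      fix j
      have "(\<Sum>k\<in>{1..d}. (c * durations n t s j * \<xi> k)\<^sup>2) / 4 = c\<^sup>2 * (\<Sum>k\<in>{1..d}. (\<xi> k)\<^sup>2) / 4 * (durations n t s j)\<^sup>2"
        by (simp add: power_mult_distrib sum_distrib_left sum_distrib_right mult_ac)
      then show "(\<integral>\<^sup>+v. ennreal (exp (\<Sum>k\<in>{1..d}. (c * durations n t s j * \<xi> k) * v k)) \<partial>uniform_sphere d)
        = hyp01 (real d / 2) (c\<^sup>2 * (\<Sum>k\<in>{1..d}. (\<xi> k)\<^sup>2) / 4 * (durations n t s j)\<^sup>2)"
        using mgf_uniform_sphere[OF d prob_space_uniform_sphere, of "\<lambda>k. c * durations n t s j * \<xi> k"] by simp
    qed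
    finally show ?thesis .
  qed
  have "(\<integral>\<^sup>+\<omega>. ennreal (exp (\<Sum>k\<in>{1..d}. \<xi> k * flight_position d n c t V \<tau> \<omega> k)) \<partial>M)
    = (\<integral>\<^sup>+x. h (fst x) (snd x) \<partial>distr M (?S \<Otimes>\<^sub>M ?T) (\<lambda>\<omega>. (\<tau> \<omega>, directions \<omega>)))"
    unfolding h using measurable_times measurable_directions h_meas by (subst nn_integral_distr) auto
  also have "distr M (?S \<Otimes>\<^sub>M ?T) (\<lambda>\<omega>. (\<tau> \<omega>, directions \<omega>)) = distr M ?S \<tau> \<Otimes>\<^sub>M ?U"
    using distr_pair_eq_if_indep_set[OF measurable_times measurable_directions indep_times]
    by (simp only: distr_directions)
  also have "(\<integral>\<^sup>+x. h (fst x) (snd x) \<partial>(distr M ?S \<tau> \<Otimes>\<^sub>M ?U)) = (\<integral>\<^sup>+s. \<integral>\<^sup>+v. h s v \<partial>?U \<partial>distr M ?S \<tau>)"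
  proof -
    interpret PiU: prob_space ?U by (intro prob_space_PiM prob_space_uniform_sphere)
    have "(\<lambda>x. h (fst x) (snd x)) \<in> borel_measurable (distr M ?S \<tau> \<Otimes>\<^sub>M ?U)"
      using h_meas sets_pair_measure_cong[of "distr M ?S \<tau>" ?S ?U ?T] sets_PU
      by (simp cong: measurable_cong_sets)
    from PiU.nn_integral_fst[OF this] show ?thesis by simp
  qed
  \<comment> \<open>The independence assumption is stated over \<open>borel\<close> and the density
    of the durations over \<open>lborel\<close>; both generate the same sigma-algebra.\<close>
  also have "distr M ?S \<tau> = distr M (PiM {1..n} (\<lambda>_. lborel)) \<tau>"
    by (intro distr_cong sets_PiM_cong) auto
  also have "\<dots> = density (PiM {1..n} (\<lambda>_. lborel)) (\<lambda>s. ennreal (f s))"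
    using distributed_times by (rule distributed_distr_eq_density)
  also have "(\<integral>\<^sup>+s. \<integral>\<^sup>+v. h s v \<partial>?U \<partial>density (PiM {1..n} (\<lambda>_. lborel)) (\<lambda>s. ennreal (f s)))
    = (\<integral>\<^sup>+s. ennreal (f s) * (\<integral>\<^sup>+v. h s v \<partial>?U) \<partial>PiM {1..n} (\<lambda>_. lborel))"
  proof (rule nn_integral_density[OF fm])
    have "(\<lambda>s. durations n t s j) \<in> borel_measurable (PiM {1..n} (\<lambda>_. lborel))" if "j \<in> {1..n+1}" for j
      using measurable_durations[OF that, of t] by (simp cong: measurable_cong_sets sets_PiM_cong)
    then show "(\<lambda>s. \<integral>\<^sup>+v. h s v \<partial>?U) \<in> borel_measurable (PiM {1..n} (\<lambda>_. lborel))"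
      unfolding inner
      by (intro borel_measurable_prod_ennreal measurable_compose[OF _ measurable_hyp01] borel_measurable_times
            borel_measurable_power borel_measurable_const) auto
  qed
  finally show ?thesis unfolding inner .
qed

end

text \<open>The hypothesis \<open>q a = real d / 2\<close> is where the flight meets the convolution
  family: the transform of a direction must be the member of the family that belongs to the exponent
  of the durations.\<close>

lemma (in random_flight) distributed_projection:
  assumes q: "convolution_family q" and f: "f = dirichlet_density a n t" and a: "a > 0" and qa: "q a = real d / 2"
    and ct: "c > 0" "t > 0" and d: "d \<ge> 2" and m: "m \<le> d"
    and Q: "Q = q ((real n + 1) * a)" "Q - real m / 2 > 0"
  shows "distributed M (PiM {1..m} (\<lambda>_. lborel)) (\<lambda>\<omega>. restrict (flight_position d n c t V \<tau> \<omega>) {1..m})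
     (\<lambda>x. ennreal (radial_density Q m (c * t) x))"
proof (rule distr_eq_radial_density)
  show "c * t > 0" using ct by simp
  show "Q - real m / 2 > 0" by (rule Q)
  have fm: "(\<lambda>s. ennreal (f s)) \<in> borel_measurable (PiM {1..n} (\<lambda>_. lborel))"
    using distributed_times by (auto simp: distributed_def)
  show "(\<lambda>\<omega>. restrict (flight_position d n c t V \<tau> \<omega>) {1..m}) \<in> M \<rightarrow>\<^sub>M PiM {1..m} (\<lambda>_. lborel)"
  proof (rule measurable_restrict)
    fix k assume k: "k \<in> {1..m}"
    have "(\<lambda>\<omega>. durations n t (\<tau> \<omega>) j) \<in> borel_measurable M" if "j \<in> {1..n+1}" for j
      using measurable_compose[OF measurable_times measurable_durations[OF that]] .
    moreover have "(\<lambda>\<omega>. V j \<omega> k) \<in> borel_measurable M" if "j \<in> {1..n+1}" for j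
      using k m measurable_compose[OF measurable_direction[OF that] measurable_component_singleton[of k]] by simp
    ultimately show "(\<lambda>\<omega>. flight_position d n c t V \<tau> \<omega> k) \<in> M \<rightarrow>\<^sub>M lborel"
      using k m unfolding flight_position_def by (auto intro!: borel_measurable_times borel_measurable_sum)
  qed
  fix \<xi> :: "nat \<Rightarrow> real"
  \<comment> \<open>Extending the frequency by 0 turns the transform of the projection into one of
    the full position, with the same sum of squares.\<close>
  define \<xi>' where "\<xi>' k = (if k \<in> {1..m} then \<xi> k else 0)" for k
  have extend: "(\<Sum>k\<in>{1..m}. g k) = (\<Sum>k\<in>{1..d}. g' k)" if "\<And>k. g' k = (if k \<in> {1..m} then g k else 0)" for g g' :: "nat \<Rightarrow> real"
    using m that by (intro sum.mono_neutral_cong_left) auto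
  have "(\<integral>\<^sup>+\<omega>. ennreal (exp (\<Sum>i\<in>{1..m}. \<xi> i * restrict (flight_position d n c t V \<tau> \<omega>) {1..m} i)) \<partial>M)
    = (\<integral>\<^sup>+\<omega>. ennreal (exp (\<Sum>k\<in>{1..d}. \<xi>' k * flight_position d n c t V \<tau> \<omega> k)) \<partial>M)"
  proof -
    have "(\<Sum>i\<in>{1..m}. \<xi> i * restrict (flight_position d n c t V \<tau> \<omega>) {1..m} i)
      = (\<Sum>k\<in>{1..d}. \<xi>' k * flight_position d n c t V \<tau> \<omega> k)" for \<omega>
      by (rule extend) (simp add: \<xi>'_def)
    then show ?thesis by (simp only:)
  qed
  also have "\<dots> = hyp01 Q (c\<^sup>2 * (\<Sum>k\<in>{1..d}. (\<xi>' k)\<^sup>2) / 4 * t\<^sup>2)"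
    unfolding mgf_flight_position[OF d fm] unfolding f qa[symmetric] Q(1)
    by (rule nn_integral_dirichlet_hyp01[OF q a ct(2)]) (simp add: sum_nonneg)
  also have "(\<Sum>k\<in>{1..d}. (\<xi>' k)\<^sup>2) = (\<Sum>i\<in>{1..m}. (\<xi> i)\<^sup>2)"
    by (rule extend[symmetric]) (simp add: \<xi>'_def)
  finally show "(\<integral>\<^sup>+\<omega>. ennreal (exp (\<Sum>i\<in>{1..m}. \<xi> i * restrict (flight_position d n c t V \<tau> \<omega>) {1..m} i)) \<partial>M)
     = hyp01 Q ((c * t)\<^sup>2 * (\<Sum>i\<in>{1..m}. (\<xi> i)\<^sup>2) / 4)"
    by (simp add: power_mult_distrib mult_ac)
qed

text \<open>The parameter is (b + 1)/2 at the accumulated exponent b = (n+1)(d-1). In the same way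
  the density of Y belongs to b + 1 at b = (n+1)(d/2-1).\<close>

lemma density_X_proj_eq_radial_density:
  "density_X_proj d m n c t = radial_density (((real n + 1) * (real d - 1) + 1) / 2) m (c * t)"
proof -
  have "(real n + 1) / 2 * (real d - 1) + 1 / 2 = ((real n + 1) * (real d - 1) + 1) / 2"
    "(real n + 1) / 2 * (real d - 1) + (1 - real m) / 2 = ((real n + 1) * (real d - 1) + 1) / 2 - real m / 2"
    "(real n + 1) / 2 * (real d - 1) - (real m + 1) / 2 = ((real n + 1) * (real d - 1) + 1) / 2 - real m / 2 - 1"
    "(real n + 1) * (real d - 1) - 1 = 2 * (((real n + 1) * (real d - 1) + 1) / 2) - 2"
    by (simp_all add: field_simps)
  then show ?thesis
    by (intro ext) (simp only: density_X_proj_def radial_density_def power_mult_distrib)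
qed

lemma density_Y_proj_eq_radial_density:
  "density_Y_proj d m n c t = radial_density ((real n + 1) * (real d / 2 - 1) + 1) m (c * t)"
proof -
  have "(real n + 1) * (real d / 2 - 1) - real m / 2 = (real n + 1) * (real d / 2 - 1) + 1 - real m / 2 - 1"
    "2 * (real n + 1) * (real d / 2 - 1) = 2 * ((real n + 1) * (real d / 2 - 1) + 1) - 2"
    by (simp_all add: field_simps)
  then show ?thesis
    by (intro ext) (simp only: density_Y_proj_def radial_density_def power_mult_distrib)
qed

lemma density_X_proj_full: "density_X_proj d d n c t = density_X d n c t"
proof -
  have "(real n + 1) / 2 * (real d - 1) + (1 - real d) / 2 = real n / 2 * (real d - 1)"
    "(real n + 1) / 2 * (real d - 1) - (real d + 1) / 2 = real n / 2 * (real d - 1) - 1"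
    by (simp_all add: field_simps)
  then show ?thesis by (intro ext) (simp only: density_X_proj_def density_X_def)
qed

lemma density_Y_proj_full: "density_Y_proj d d n c t = density_Y d n c t"
proof -
  have "(real n + 1) * (real d / 2 - 1) + 1 - real d / 2 = real n * (real d / 2 - 1)"
    "(real n + 1) * (real d / 2 - 1) - real d / 2 = real n * (real d / 2 - 1) - 1"
    by (simp_all add: field_simps)
  then show ?thesis by (intro ext) (simp only: density_Y_proj_def density_Y_def)
qed

lemma restrict_flight_position:
  "restrict (flight_position d n c t V \<tau> \<omega>) {1..d} = flight_position d n c t V \<tau> \<omega>"
  by (simp add: flight_position_def)

theorem theorem4:
  fixes c t :: real and n :: nat
  assumes "c > 0" and "t > 0" and "n \<ge> 1"
  shows
    "(\<forall>d \<ge> 2. density_X_proj d d n c t = density_X d n c t \<and>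
        (\<forall>(M :: 'a measure) V \<tau>. random_flight M d n (dirichlet_density (real d - 1) n t) V \<tau> \<longrightarrow>
          (\<forall>m. 1 \<le> m \<and> m < d \<longrightarrow>
             distributed M (PiM {1..m} (\<lambda>_. lborel))
               (\<lambda>\<omega>. restrict (flight_position d n c t V \<tau> \<omega>) {1..m})
               (\<lambda>x. ennreal (density_X_proj d m n c t x))) \<and>
          distributed M (PiM {1..d} (\<lambda>_. lborel))
            (flight_position d n c t V \<tau>) (\<lambda>x. ennreal (density_X d n c t x))))
     \<and>
     (\<forall>d \<ge> 3. density_Y_proj d d n c t = density_Y d n c t \<and>
        (\<forall>(M :: 'b measure) V \<tau>. random_flight M d n (dirichlet_density (real d / 2 - 1) n t) V \<tau> \<longrightarrow>
          (\<forall>m. 1 \<le> m \<and> m < d \<longrightarrow>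
             distributed M (PiM {1..m} (\<lambda>_. lborel))
               (\<lambda>\<omega>. restrict (flight_position d n c t V \<tau> \<omega>) {1..m})
               (\<lambda>y. ennreal (density_Y_proj d m n c t y))) \<and>
          distributed M (PiM {1..d} (\<lambda>_. lborel))
            (flight_position d n c t V \<tau>) (\<lambda>y. ennreal (density_Y d n c t y))))"
proof -
  have X: "distributed M (PiM {1..m} (\<lambda>_. lborel)) (\<lambda>\<omega>. restrict (flight_position d n c t V \<tau> \<omega>) {1..m})
      (\<lambda>x. ennreal (density_X_proj d m n c t x))"
    if d: "d \<ge> 2" and m: "m \<le> d" and flight: "random_flight M d n (dirichlet_density (real d - 1) n t) V \<tau>"
    for d m V \<tau> and M :: "'a measure"
  proof -
    \<comment> \<open>This is 2Q - d, so m \<le> d gives Q - m/2 > 0; n \<ge> 1 is needed here when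
      m = d.\<close>
    have "real n * (real d - 1) > 0" "real m \<le> real d" using d m assms(3) by auto
    then have "((real n + 1) * (real d - 1) + 1) / 2 - real m / 2 > 0" by (simp add: field_simps)
    then show ?thesis
      unfolding density_X_proj_eq_radial_density using assms d m
      by (intro random_flight.distributed_projection[OF flight convolution_family_half refl]) auto
  qed
  have Y: "distributed M (PiM {1..m} (\<lambda>_. lborel)) (\<lambda>\<omega>. restrict (flight_position d n c t V \<tau> \<omega>) {1..m})
      (\<lambda>y. ennreal (density_Y_proj d m n c t y))"
    if d: "d \<ge> 3" and m: "m \<le> d" and flight: "random_flight M d n (dirichlet_density (real d / 2 - 1) n t) V \<tau>"
    for d m V \<tau> and M :: "'b measure"
  proof -
    \<comment> \<open>Here the quantity is Q - d/2 itself, positive because d \<ge> 3 and n \<ge>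
      1.\<close>
    have "real n * (real d / 2 - 1) > 0" "real m \<le> real d" using d m assms(3) by auto
    then have "(real n + 1) * (real d / 2 - 1) + 1 - real m / 2 > 0" by (simp add: field_simps)
    then show ?thesis
      unfolding density_Y_proj_eq_radial_density using assms d m
      by (intro random_flight.distributed_projection[OF flight convolution_family_plus_one refl]) auto
  qed
  have X_full: "distributed M (PiM {1..d} (\<lambda>_. lborel)) (flight_position d n c t V \<tau>) (\<lambda>x. ennreal (density_X d n c t x))"
    if "d \<ge> 2" "random_flight M d n (dirichlet_density (real d - 1) n t) V \<tau>" for d V \<tau> and M :: "'a measure"
    using X[OF that(1) order_refl that(2)] unfolding density_X_proj_full restrict_flight_position .
  have Y_full: "distributed M (PiM {1..d} (\<lambda>_. lborel)) (flight_position d n c t V \<tau>) (\<lambda>y. ennreal (density_Y d n c t y))"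
    if "d \<ge> 3" "random_flight M d n (dirichlet_density (real d / 2 - 1) n t) V \<tau>" for d V \<tau> and M :: "'b measure"
    using Y[OF that(1) order_refl that(2)] unfolding density_Y_proj_full restrict_flight_position .
  show ?thesis
    by (intro conjI allI impI density_X_proj_full density_Y_proj_full X_full Y_full X Y) auto
qed

end
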